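(* Let $G$ be a finite simple graph, let $e=\{u,v\}$ be a splitting edge of $G$, set $H=G\setminus(N(u)\cup N(v))$ and $n=|N(u)\cup N(v)|-2$. Then (i) $\mathrm{reg}(\mathcal{I}(G))=\max\{2,\ \mathrm{reg}(\mathcal{I}(G\setminus e)),\ \mathrm{reg}(\mathcal{I}(H))+1\}$; (ii) $\mathrm{pd}(\mathcal{I}(G))=\max\{\mathrm{pd}(\mathcal{I}(G\setminus e)),\ \mathrm{pd}(\mathcal{I}(H))+n+1\}$.
   Context: Graphs are undirected, without loops or multiple edges, not necessarily connected. The vertices of $G$ are identified with the variables of $R=k[x_1,\dots,x_m]$, $k$ an arbitrary field, and $\mathcal{I}(G)=(\{x_ix_j\mid\{x_i,x_j\}\in E_G\})\subseteq R$ is the edge ideal; a graph without edges has edge ideal $(0)$, and edge ideals of subgraphs are viewed in $R$. $N(x)$ is the set of neighbors of $x$; $G\setminus e$ is $G$ with the edge $e$ deleted, and $G\setminus S$ is $G$ with the vertices of $S$ and their incident edges deleted. For a nonzero homogeneous ideal $I$ with graded Betti numbers $\beta_{i,j}(I)=\dim_k\mathrm{Tor}_i^R(I,k)_j$, $\mathrm{reg}(I)=\max\{j-i\mid\beta_{i,j}(I)\ne0\}$ and $\mathrm{pd}(I)=\max\{i\mid\beta_{i,j}(I)\neq0\text{ for some }j\}$. For the zero ideal, $\mathrm{reg}((0))=1$ and $\mathrm{pd}((0))=-1$ (consistent with the convention $\beta_{-1,0}(I)=1$, $\beta_{-1,j}(I)=0$ for $j\ne0$, for every ideal $I$). $\mathcal{G}(I)$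 is the minimal set of monomial generators of a monomial ideal $I$. An expression $I=J+K$ with $J,K$ nonzero monomial ideals is a splitting of $I$ if (1) $\mathcal{G}(I)$ is the disjoint union of $\mathcal{G}(J)$ and $\mathcal{G}(K)$, and (2) there is a function $\mathcal{G}(J\cap K)\to\mathcal{G}(J)\times\mathcal{G}(K)$, $w\mapsto(\phi(w),\psi(w))$, such that (a) $w=\mathrm{lcm}(\phi(w),\psi(w))$ for all $w$, and (b) for every nonempty $S\subseteq\mathcal{G}(J\cap K)$, both $\mathrm{lcm}(\phi(S))$ and $\mathrm{lcm}(\psi(S))$ strictly divide $\mathrm{lcm}(S)$. An edge $e=\{u,v\}$ is a splitting edge of $G$ if $\mathcal{I}(G)=(uv)+\mathcal{I}(G\setminus e)$ is a splitting. *)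

theory Defs
  imports Complex_Main "HOL-Library.Poly_Mapping"
begin

section \<open>Graphs\<close>

record 'v graph =
  verts :: "'v set"
  edges :: "'v set set"

definition simple_graph :: "'v graph \<Rightarrow> bool" where
  "simple_graph G \<longleftrightarrow> finite (verts G) \<and> (\<forall>e\<in>edges G. e \<subseteq> verts G \<and> card e = 2)"

definition nbrs :: "'v graph \<Rightarrow> 'v \<Rightarrow> 'v set" where
  "nbrs G x = {y. {x, y} \<in> edges G}"

definition del_edge :: "'v graph \<Rightarrow> 'v set \<Rightarrow> 'v graph" where
  "del_edge G e = \<lparr>verts = verts G, edges = edges G - {e}\<rparr>"

definition del_verts :: "'v graph \<Rightarrow> 'v set \<Rightarrow> 'v graph" where
  "del_verts G S = \<lparr>verts = verts G - S, edges = {e \<in> edges G. e \<inter> S = {}}\<rparr>"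


section \<open>The polynomial ring and its monomial ideals\<close>

text \<open>Exponent vectors serve as monomials; the variables are the elements of \<^typ>\<open>'v\<close>.
  The order that \<^theory>\<open>HOL-Library.Poly_Mapping\<close> puts on exponent vectors is lexicographic,
  hence the separate relation \<open>mono_dvd\<close> for divisibility.\<close>

type_synonym 'v mono = "'v \<Rightarrow>\<^sub>0 nat"
type_synonym ('v, 'k) mpoly = "'v mono \<Rightarrow>\<^sub>0 'k"

definition monom :: "'v mono \<Rightarrow> ('v, 'k::field) mpoly" where
  "monom t = Poly_Mapping.single t 1"

definition var :: "'v \<Rightarrow> ('v, 'k::field) mpoly" where
  "var x = monom (Poly_Mapping.single x 1)"

definition mono_deg :: "'v mono \<Rightarrow> nat" where
  "mono_deg t = (\<Sum>x\<in>Poly_Mapping.keys t. Poly_Mapping.lookup t x)"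

definition mono_dvd :: "'v mono \<Rightarrow> 'v mono \<Rightarrow> bool" where
  "mono_dvd s t \<longleftrightarrow> (\<exists>u. t = s + u)"

definition mono_sdvd :: "'v mono \<Rightarrow> 'v mono \<Rightarrow> bool" where
  "mono_sdvd s t \<longleftrightarrow> mono_dvd s t \<and> s \<noteq> t"

definition mono_lcm :: "'v mono set \<Rightarrow> 'v mono" where
  "mono_lcm S = (THE m. (\<forall>s\<in>S. mono_dvd s m) \<and> (\<forall>m'. (\<forall>s\<in>S. mono_dvd s m') \<longrightarrow> mono_dvd m m'))"

definition ideal_gen :: "('v, 'k::field) mpoly set \<Rightarrow> ('v, 'k) mpoly set" where
  "ideal_gen S = module.span (*) S"

definition monomial_ideal :: "('v, 'k::field) mpoly set \<Rightarrow> bool" where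
  "monomial_ideal I \<longleftrightarrow> (\<exists>S. I = ideal_gen (monom ` S))"

text \<open>Minimality is meant with respect to inclusion of generating sets.\<close>

definition min_gens :: "('v, 'k::field) mpoly set \<Rightarrow> 'v mono set" where
  "min_gens I = (THE S. ideal_gen (monom ` S) = I \<and> (\<forall>S'. S' \<subset> S \<longrightarrow> ideal_gen (monom ` S') \<noteq> I))"

definition edge_ideal :: "'v graph \<Rightarrow> ('v, 'k::field) mpoly set" where
  "edge_ideal G = ideal_gen {var x * var y | x y. {x, y} \<in> edges G}"


section \<open>Splittings\<close>

definition is_splitting ::
  "('v, 'k::field) mpoly set \<Rightarrow> ('v, 'k) mpoly set \<Rightarrow> ('v, 'k) mpoly set \<Rightarrow> bool" where
  "is_splitting I J K \<longleftrightarrow>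
     monomial_ideal J \<and> J \<noteq> {0} \<and> monomial_ideal K \<and> K \<noteq> {0} \<and>
     I = {a + b | a b. a \<in> J \<and> b \<in> K} \<and>
     min_gens I = min_gens J \<union> min_gens K \<and> min_gens J \<inter> min_gens K = {} \<and>
     (\<exists>\<phi> \<psi>.
        (\<forall>w\<in>min_gens (J \<inter> K). \<phi> w \<in> min_gens J \<and> \<psi> w \<in> min_gens K \<and> w = mono_lcm {\<phi> w, \<psi> w}) \<and>
        (\<forall>S. S \<subseteq> min_gens (J \<inter> K) \<and> S \<noteq> {} \<longrightarrow>
           mono_sdvd (mono_lcm (\<phi> ` S)) (mono_lcm S) \<and> mono_sdvd (mono_lcm (\<psi> ` S)) (mono_lcm S)))"

text \<open>This notion depends on the coefficient field, which does not occur in the type of the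
  graph and is therefore passed as a type argument.\<close>

definition splitting_edge :: "'k::field itself \<Rightarrow> 'v graph \<Rightarrow> 'v \<Rightarrow> 'v \<Rightarrow> bool" where
  "splitting_edge TYPE('k) G u v \<longleftrightarrow> {u, v} \<in> edges G \<and>
     is_splitting (edge_ideal G :: ('v, 'k) mpoly set)
       (ideal_gen {var u * var v}) (edge_ideal (del_edge G {u, v}))"


section \<open>Graded Betti numbers\<close>

text \<open>The free module \<open>A\<^sup>r\<close> consists of the maps \<^typ>\<open>nat \<Rightarrow>\<^sub>0 'a\<close> supported on \<open>{..<r}\<close>;
  \<open>lin_map d\<close> is the \<open>A\<close>-linear map that sends the \<open>a\<close>-th standard basis vector to \<open>d a\<close>.\<close>

definition smult :: "'a::comm_ring_1 \<Rightarrow> (nat \<Rightarrow>\<^sub>0 'a) \<Rightarrow> (nat \<Rightarrow>\<^sub>0 'a)" where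
  "smult c f = Poly_Mapping.map ((*) c) f"

definition free_mod :: "nat \<Rightarrow> (nat \<Rightarrow>\<^sub>0 'a::comm_ring_1) set" where
  "free_mod r = {f. Poly_Mapping.keys f \<subseteq> {..<r}}"

definition lin_map :: "(nat \<Rightarrow> (nat \<Rightarrow>\<^sub>0 'a)) \<Rightarrow> (nat \<Rightarrow>\<^sub>0 'a) \<Rightarrow> (nat \<Rightarrow>\<^sub>0 'a::comm_ring_1)" where
  "lin_map d f = (\<Sum>a\<in>Poly_Mapping.keys f. smult (Poly_Mapping.lookup f a) (d a))"

definition homogeneous :: "('v, 'k::field) mpoly \<Rightarrow> int \<Rightarrow> bool" where
  "homogeneous p d \<longleftrightarrow> (\<forall>t\<in>Poly_Mapping.keys p. int (mono_deg t) = d)"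

text \<open>Data of an augmented complex \<open>\<cdots> \<rightarrow> F\<^sub>1 \<rightarrow> F\<^sub>0 \<rightarrow> R\<close> of finitely generated graded free modules:
  the \<open>i\<close>-th module has rank \<open>frank i\<close>, its \<open>a\<close>-th basis vector has degree \<open>fdeg i a\<close> and is mapped
  to \<open>aug a\<close> if \<open>i = 0\<close>; \<open>diff i a\<close> is the image in the \<open>i\<close>-th module of the \<open>a\<close>-th basis vector of
  the \<open>(i+1)\<close>-st.\<close>

record (overloaded) ('v, 'k::zero) free_complex =
  frank :: "nat \<Rightarrow> nat"
  fdeg :: "nat \<Rightarrow> nat \<Rightarrow> int"
  aug :: "nat \<Rightarrow> ('v, 'k) mpoly"
  diff :: "nat \<Rightarrow> nat \<Rightarrow> (nat \<Rightarrow>\<^sub>0 ('v, 'k) mpoly)"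

definition aug_map :: "('v, 'k::field) free_complex \<Rightarrow> (nat \<Rightarrow>\<^sub>0 ('v, 'k) mpoly) \<Rightarrow> ('v, 'k) mpoly" where
  "aug_map F f = (\<Sum>a\<in>Poly_Mapping.keys f. Poly_Mapping.lookup f a * aug F a)"

definition graded_free_resolution ::
  "('v, 'k::field) mpoly set \<Rightarrow> ('v, 'k) free_complex \<Rightarrow> bool" where
  "graded_free_resolution I F \<longleftrightarrow>
     (\<forall>a<frank F 0. homogeneous (aug F a) (fdeg F 0 a)) \<and>
     (\<forall>i. \<forall>a<frank F (Suc i). diff F i a \<in> free_mod (frank F i) \<and>
        (\<forall>b<frank F i. homogeneous (Poly_Mapping.lookup (diff F i a) b) (fdeg F (Suc i) a - fdeg F i b))) \<and>
     aug_map F ` free_mod (frank F 0) = I \<and>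
     {f \<in> free_mod (frank F 0). aug_map F f = 0} = lin_map (diff F 0) ` free_mod (frank F 1) \<and>
     (\<forall>i. {f \<in> free_mod (frank F (Suc i)). lin_map (diff F i) f = 0} =
        lin_map (diff F (Suc i)) ` free_mod (frank F (Suc (Suc i))))"

text \<open>The complex \<open>F \<otimes>\<^sub>R k\<close>, where \<open>k = R / (all variables)\<close>: the degree \<open>j\<close> part of \<open>F\<^sub>i \<otimes>\<^sub>R k\<close>
  is the \<open>k\<close>-vector space on the basis vectors of \<open>F\<^sub>i\<close> of degree \<open>j\<close>, and the differential is given by
  the images in \<open>k\<close>, that is the constant terms, of the matrix entries.\<close>

definition red_part :: "('v, 'k::field) free_complex \<Rightarrow> nat \<Rightarrow> int \<Rightarrow> (nat \<Rightarrow>\<^sub>0 'k) set" where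
  "red_part F i j = {c. Poly_Mapping.keys c \<subseteq> {a. a < frank F i \<and> fdeg F i a = j}}"

definition red_diff :: "('v, 'k::field) free_complex \<Rightarrow> nat \<Rightarrow> (nat \<Rightarrow>\<^sub>0 'k) \<Rightarrow> (nat \<Rightarrow>\<^sub>0 'k)" where
  "red_diff F i = lin_map (\<lambda>a. Poly_Mapping.map (\<lambda>p. Poly_Mapping.lookup p 0) (diff F i a))"

definition red_cycles :: "('v, 'k::field) free_complex \<Rightarrow> nat \<Rightarrow> int \<Rightarrow> (nat \<Rightarrow>\<^sub>0 'k) set" where
  "red_cycles F i j =
     (case i of 0 \<Rightarrow> red_part F 0 j | Suc l \<Rightarrow> {c \<in> red_part F (Suc l) j. red_diff F l c = 0})"

definition red_boundaries :: "('v, 'k::field) free_complex \<Rightarrow> nat \<Rightarrow> int \<Rightarrow> (nat \<Rightarrow>\<^sub>0 'k) set" where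
  "red_boundaries F i j = red_diff F i ` red_part F (Suc i) j"

text \<open>\<open>dim\<^sub>k H\<^sub>i(F \<otimes>\<^sub>R k)\<^sub>j\<close>. The difference is not truncated, as the boundaries form a subspace of the
  finite-dimensional space of cycles.\<close>

definition red_homology_dim :: "('v, 'k::field) free_complex \<Rightarrow> nat \<Rightarrow> int \<Rightarrow> nat" where
  "red_homology_dim F i j =
     vector_space.dim smult (red_cycles F i j) - vector_space.dim smult (red_boundaries F i j)"

text \<open>\<open>\<beta>\<^sub>i\<^sub>,\<^sub>j(I) = dim\<^sub>k Tor\<^sub>i\<^sup>R(I, k)\<^sub>j\<close>, with \<open>Tor\<close> computed from a chosen graded free resolution
  of \<open>I\<close>.\<close>

definition betti :: "('v, 'k::field) mpoly set \<Rightarrow> nat \<Rightarrow> int \<Rightarrow> nat" where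
  "betti I i j = red_homology_dim (SOME F. graded_free_resolution I F) i j"

definition reg :: "('v, 'k::field) mpoly set \<Rightarrow> int" where
  "reg I = (if I = {0} then 1 else Max {j - int i | i j. betti I i j \<noteq> 0})"

definition pd :: "('v, 'k::field) mpoly set \<Rightarrow> int" where
  "pd I = (if I = {0} then - 1 else Max {int i | i j. betti I i j \<noteq> 0})"

end

theory Submission
  imports Defs "HOL-Library.Function_Algebras"
begin

text \<open>The mapping cone of a comparison map \<open>R / (M : m) \<rightarrow> R / M\<close> lifting multiplication by \<open>m\<close>
  resolves \<open>R / (M + (m))\<close>. If the lift can be chosen with entries in the ideal of the variables, the cone splits
  after reduction, so the nonzero graded Betti numbers of \<open>R / (M + (m))\<close> are those of \<open>R / M\<close> and the
  shifted ones of \<open>R / (M : m)\<close>. This happens when \<open>m = w z\<close> with a variable \<open>w\<close> and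
  \<open>(M : m) z \<subseteq> M\<close>, since then \<open>w\<close> times a lift of multiplication by \<open>z\<close> will do.

  For a splitting edge, one of the vertices, say \<open>u\<close>, has all its neighbours other than \<open>v\<close> adjacent to
  \<open>v\<close>. Hence the above applies to \<open>M = I(G - e)\<close>, \<open>w = u\<close>, \<open>z = v\<close>, where \<open>M : uv\<close> is generated by
  \<open>I(H)\<close> and the \<open>n\<close> vertices other than \<open>u\<close>, \<open>v\<close> adjacent to \<open>u\<close> or \<open>v\<close>. These do not occur in
  \<open>I(H)\<close>, and adding such a variable \<open>y\<close> to an ideal is the case \<open>w = y\<close>, \<open>z = 1\<close>: the regularity
  stays and the projective dimension grows by one.\<close>

section \<open>Polynomials, degrees and monomial ideals\<close>

text \<open>\<open>betti\<close> is read off from one resolution picked by \<open>SOME\<close>, so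
  no Betti number is accessible before resolutions are known to exist and to agree. Both facts are
  proved for the set of pairs (i, j) with Tor_i(R / I, k)_j nonzero rather than for dimensions,
  since \<open>reg\<close> and \<open>pd\<close> depend on nothing more. With R / I in place of I
  the zero ideal needs no separate treatment in the cones: R has the single pair (0, 0), and the
  passage to I, which adds 1 to the regularity and subtracts 1 from the projective dimension, turns
  this into the conventional values 1 and -1. The obstacle is cancellation: a cone of resolutions
  can have a comparison map with unit entries, and then only bounds would follow. Writing the new
  generator as w z removes the units all at once, without any knowledge of the lift of z. The
  constants of the theorem come from the shifts. Adjoining uv raises positions by 1 and degrees by
  2, adjoining a variable raises both by 1; so regularity gains 1 in all and projective dimension n
  + 1. The entry 2 reflects that the regularity of I(H) is at least 1.\<close>

lemma lookup_single_mult: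
  fixes p :: "('v, 'k::field) mpoly"
  shows "Poly_Mapping.lookup (monom m * p) (m + s) = Poly_Mapping.lookup p s"
proof -
  have "Poly_Mapping.lookup (monom m * p) (m + s) =
      Sum_any (\<lambda>l. Poly_Mapping.lookup (monom m :: ('v, 'k) mpoly) l *
        Sum_any (\<lambda>q. Poly_Mapping.lookup p q when m + s = l + q))"
    by (simp add: lookup_mult)
  also have "\<dots> = Sum_any (\<lambda>l. (Sum_any (\<lambda>q. Poly_Mapping.lookup p q when m + s = l + q)) when m = l)"
    by (rule arg_cong[where f = Sum_any], rule ext) (simp add: monom_def lookup_single when_def)
  also have "\<dots> = Poly_Mapping.lookup p s"
    by simp
  finally show ?thesis .
qed

lemma keys_monom_mult:
  fixes p :: "('v, 'k::field) mpoly"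
  shows "Poly_Mapping.keys (monom m * p) = (+) m ` Poly_Mapping.keys p"
proof
  show "Poly_Mapping.keys (monom m * p) \<subseteq> (+) m ` Poly_Mapping.keys p"
    using keys_mult[of "monom m" p] by (auto simp: monom_def split: if_splits)
  show "(+) m ` Poly_Mapping.keys p \<subseteq> Poly_Mapping.keys (monom m * p)"
    by (auto simp: in_keys_iff lookup_single_mult)
qed

lemma monom_add: "monom (s + t) = monom s * (monom t :: ('v, 'k::field) mpoly)"
  by (simp add: monom_def mult_single)

lemma keys_monom [simp]: "Poly_Mapping.keys (monom t :: ('v, 'k::field) mpoly) = {t}"
  by (simp add: monom_def)

lemma mono_deg_UNIV: "mono_deg (t :: 'v::finite mono) = (\<Sum>x\<in>UNIV. Poly_Mapping.lookup t x)"
  unfolding mono_deg_def by (rule sum.mono_neutral_left) (auto simp: in_keys_iff)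

lemma mono_deg_add: "mono_deg (s + t) = mono_deg s + mono_deg (t :: 'v::finite mono)"
  by (simp add: mono_deg_UNIV lookup_add sum.distrib)

lemma mono_deg_0 [simp]: "mono_deg 0 = 0"
  by (simp add: mono_deg_def)

lemma mono_deg_single [simp]: "mono_deg (Poly_Mapping.single x (Suc 0)) = 1"
  by (simp add: mono_deg_def)

lemma mono_deg_eq_0: "mono_deg (t :: 'v::finite mono) = 0 \<Longrightarrow> t = 0"
  by (rule poly_mapping_eqI) (auto simp: mono_deg_UNIV)

lemma mono_dvd_iff: "mono_dvd s t \<longleftrightarrow> (\<forall>x. Poly_Mapping.lookup s x \<le> Poly_Mapping.lookup t x)"
proof
  assume "\<forall>x. Poly_Mapping.lookup s x \<le> Poly_Mapping.lookup t x"
  then have "t = s + (t - s)"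
    by (intro poly_mapping_eqI) (simp add: lookup_add lookup_minus)
  then show "mono_dvd s t" unfolding mono_dvd_def by blast
qed (auto simp: mono_dvd_def lookup_add)

lemma mono_dvd_refl [simp]: "mono_dvd s s"
  by (simp add: mono_dvd_iff)

lemma mono_dvd_trans: "mono_dvd s t \<Longrightarrow> mono_dvd t w \<Longrightarrow> mono_dvd s w"
  by (meson mono_dvd_iff order_trans)

lemma mono_dvd_antisym: "mono_dvd s t \<Longrightarrow> mono_dvd t s \<Longrightarrow> s = t"
  by (metis mono_dvd_iff order_antisym poly_mapping_eqI)

lemma mono_dvd_deg_eq: "mono_dvd s (t :: 'v::finite mono) \<Longrightarrow> mono_deg t \<le> mono_deg s \<Longrightarrow> s = t"
  by (auto simp: mono_dvd_def mono_deg_add dest: mono_deg_eq_0)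

lemma homogeneous_0 [simp]: "homogeneous 0 d"
  by (simp add: homogeneous_def)

lemma homogeneous_monom: "homogeneous (monom t :: ('v, 'k::field) mpoly) (int (mono_deg t))"
  by (simp add: homogeneous_def)

lemma homogeneous_1: "homogeneous (1 :: ('v, 'k::field) mpoly) 0"
  by (simp add: homogeneous_def)

lemma homogeneous_add: "homogeneous p d \<Longrightarrow> homogeneous q d \<Longrightarrow> homogeneous (p + q) d"
  using keys_add[of p q] by (auto simp: homogeneous_def)

lemma homogeneous_uminus: "homogeneous p d \<Longrightarrow> homogeneous (- p) d"
  by (simp add: homogeneous_def in_keys_iff)

lemma homogeneous_diff: "homogeneous p d \<Longrightarrow> homogeneous q d \<Longrightarrow> homogeneous (p - q) d"
  using homogeneous_add[of p d "- q"] by (simp add: homogeneous_uminus)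

lemma homogeneous_sum: "(\<And>a. a \<in> A \<Longrightarrow> homogeneous (f a) d) \<Longrightarrow> homogeneous (sum f A) d"
  by (induction A rule: infinite_finite_induct) (auto intro: homogeneous_add)

lemma homogeneous_mult:
  fixes p q :: "('v::finite, 'k::field) mpoly"
  shows "homogeneous p d \<Longrightarrow> homogeneous q e \<Longrightarrow> homogeneous (p * q) (d + e)"
  using keys_mult[of p q] by (fastforce simp: homogeneous_def mono_deg_add)

section \<open>Homogeneous components and constant terms\<close>

definition hom_comp :: "int \<Rightarrow> ('v, 'k::field) mpoly \<Rightarrow> ('v, 'k) mpoly" where
  "hom_comp d p = Abs_poly_mapping (\<lambda>t. if int (mono_deg t) = d then Poly_Mapping.lookup p t else 0)"

lemma lookup_hom_comp:
  "Poly_Mapping.lookup (hom_comp d p) t = (if int (mono_deg t) = d then Poly_Mapping.lookup p t else 0)"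
proof -
  have "finite {t. (if int (mono_deg t) = d then Poly_Mapping.lookup p t else 0) \<noteq> 0}"
    by (rule finite_subset[of _ "Poly_Mapping.keys p"]) (auto simp: in_keys_iff)
  then show ?thesis by (simp add: hom_comp_def)
qed

lemma homogeneous_hom_comp [simp]: "homogeneous (hom_comp d p) d"
  by (auto simp: homogeneous_def in_keys_iff lookup_hom_comp split: if_splits)

lemma hom_comp_homogeneous: "homogeneous p d \<Longrightarrow> hom_comp d p = p"
  by (rule poly_mapping_eqI) (auto simp: lookup_hom_comp homogeneous_def in_keys_iff)

lemma hom_comp_add: "hom_comp d (p + q) = hom_comp d p + hom_comp d q"
  by (rule poly_mapping_eqI) (auto simp: lookup_hom_comp lookup_add)

lemma hom_comp_0 [simp]: "hom_comp d 0 = 0"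
  by (rule poly_mapping_eqI) (auto simp: lookup_hom_comp)

lemma hom_comp_sum: "hom_comp d (sum f A) = (\<Sum>a\<in>A. hom_comp d (f a))"
  by (induction A rule: infinite_finite_induct) (auto simp: hom_comp_add)

text \<open>Removing the component of degree \<open>d - e\<close> leaves a \<open>p'\<close> without
  monomials of that degree, so \<open>p' * q\<close> has nothing in degree \<open>d\<close>. This is
  what allows factorizations to be made homogeneous in \<open>graded_map_factor\<close>.\<close>

lemma hom_comp_mult:
  fixes p q :: "('v::finite, 'k::field) mpoly"
  assumes "homogeneous q e"
  shows "hom_comp d (p * q) = hom_comp (d - e) p * q"
proof -
  define p' where "p' = p - hom_comp (d - e) p"
  have 1: "hom_comp d (hom_comp (d - e) p * q) = hom_comp (d - e) p * q"
    using homogeneous_mult[OF homogeneous_hom_comp assms, of "d - e" p]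
    by (intro hom_comp_homogeneous) simp
  have "t \<notin> Poly_Mapping.keys (p' * q)" if "int (mono_deg t) = d" for t
  proof
    assume "t \<in> Poly_Mapping.keys (p' * q)"
    then obtain r s where "t = r + s" "r \<in> Poly_Mapping.keys p'" "s \<in> Poly_Mapping.keys q"
      using keys_mult[of p' q] by blast
    with that assms show False
      by (auto simp: homogeneous_def mono_deg_add p'_def in_keys_iff lookup_minus lookup_hom_comp)
  qed
  then have 2: "hom_comp d (p' * q) = 0"
    by (intro poly_mapping_eqI) (auto simp: lookup_hom_comp in_keys_iff)
  have "hom_comp d (p * q) = hom_comp d (hom_comp (d - e) p * q + p' * q)"
    by (simp add: p'_def algebra_simps)
  then show ?thesis by (simp only: hom_comp_add 1 2) simp
qed

abbreviation const_term :: "('v, 'k::field) mpoly \<Rightarrow> 'k" where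
  "const_term p \<equiv> Poly_Mapping.lookup p 0"

lemma mono_add_eq_0: "s + t = (0 :: 'v mono) \<longleftrightarrow> s = 0 \<and> t = 0"
  by (auto simp: poly_mapping_eq_iff fun_eq_iff lookup_add)

text \<open>Exponents are natural numbers, so a sum of exponent vectors is 0 only if both are. Hence
  taking constant terms is a ring map, and \<open>red\<close> below is compatible with products of
  matrices.\<close>

lemma const_term_mult: "const_term (p * q) = const_term p * const_term (q :: ('v, 'k::field) mpoly)"
proof -
  have "const_term (p * q) = Sum_any (\<lambda>l. Poly_Mapping.lookup p l *
      Sum_any (\<lambda>r. Poly_Mapping.lookup q r when 0 = l + r))"
    by (simp add: lookup_mult)
  also have "\<dots> = Sum_any (\<lambda>l. (Poly_Mapping.lookup p l * const_term q) when 0 = l)"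
  proof (rule arg_cong[where f = Sum_any], rule ext)
    fix l :: "'v mono"
    have "(Poly_Mapping.lookup q r when 0 = l + r) = ((const_term q when l = 0) when 0 = r)" for r
      using mono_add_eq_0[of l r] by (auto simp: when_def)
    then have "Sum_any (\<lambda>r. Poly_Mapping.lookup q r when 0 = l + r)
        = Sum_any (\<lambda>r::'v mono. (const_term q when l = 0) when 0 = r)"
      by simp
    also have "\<dots> = (const_term q when l = 0)"
      by simp
    finally show "Poly_Mapping.lookup p l * Sum_any (\<lambda>r. Poly_Mapping.lookup q r when 0 = l + r)
      = (Poly_Mapping.lookup p l * const_term q when 0 = l)"
      by (auto simp: when_def)
  qed
  finally show ?thesis by simp
qed

lemma const_term_homogeneous: "homogeneous p d \<Longrightarrow> const_term p \<noteq> 0 \<Longrightarrow> d = 0"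
  by (force simp: homogeneous_def in_keys_iff)

section \<open>Monomial ideals: membership, colon ideals and adjoining a generator\<close>

interpretation ring_module: module "(*) :: 'a::comm_ring_1 \<Rightarrow> 'a \<Rightarrow> 'a"
  by unfold_locales (auto simp: algebra_simps)

text \<open>Turns later questions on colon ideals, intersections, equality and minimal generators
  into divisibility of exponent vectors. For the converse direction, \<open>p\<close> is split into
  its terms, each a multiple of a generator.\<close>

lemma monomial_span_iff:
  fixes p :: "('v, 'k::field) mpoly"
  shows "p \<in> ideal_gen (monom ` T) \<longleftrightarrow> (\<forall>s\<in>Poly_Mapping.keys p. \<exists>t\<in>T. mono_dvd t s)"
proof
  assume "p \<in> ideal_gen (monom ` T)"
  then have "p \<in> ring_module.span (monom ` T)"
    by (simp add: ideal_gen_def)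
  then show "\<forall>s\<in>Poly_Mapping.keys p. \<exists>t\<in>T. mono_dvd t s"
  proof (induction rule: ring_module.span_induct_alt)
    case (step c x y)
    then obtain t where t: "t \<in> T" "x = monom t" by blast
    show ?case
    proof
      fix s assume "s \<in> Poly_Mapping.keys (c * x + y)"
      then consider "s \<in> Poly_Mapping.keys (monom t * c)" | "s \<in> Poly_Mapping.keys y"
        using keys_add[of "c * x" y] t by (auto simp: mult.commute)
      then show "\<exists>t\<in>T. mono_dvd t s"
      proof cases
        case 1
        then show ?thesis using t by (auto simp: keys_monom_mult mono_dvd_def)
      qed (use step in auto)
    qed
  qed auto
next
  assume *: "\<forall>s\<in>Poly_Mapping.keys p. \<exists>t\<in>T. mono_dvd t s"
  have "p = (\<Sum>s\<in>Poly_Mapping.keys p. Poly_Mapping.single s (Poly_Mapping.lookup p s))"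
    by (rule poly_mapping_eqI)
      (simp add: lookup_sum lookup_single when_def in_keys_iff if_distrib cong: if_cong)
  also have "\<dots> \<in> ring_module.span (monom ` T)"
  proof (rule ring_module.span_sum)
    fix s assume "s \<in> Poly_Mapping.keys p"
    then obtain t w where "t \<in> T" "s = t + w" using * by (auto simp: mono_dvd_def)
    moreover from this have "Poly_Mapping.single s (Poly_Mapping.lookup p s) =
        Poly_Mapping.single w (Poly_Mapping.lookup p s) * monom t"
      by (simp add: monom_def mult_single add.commute)
    ultimately show "Poly_Mapping.single s (Poly_Mapping.lookup p s) \<in> ring_module.span (monom ` T)"
      using ring_module.span_scale[OF ring_module.span_base] by (metis imageI)
  qed
  finally show "p \<in> ideal_gen (monom ` T)" by (simp add: ideal_gen_def)
qed

lemma monom_in_span_iff: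
  "(monom s :: ('v, 'k::field) mpoly) \<in> ideal_gen (monom ` T) \<longleftrightarrow> (\<exists>t\<in>T. mono_dvd t s)"
  by (simp add: monomial_span_iff)

text \<open>Subtraction of exponents is truncated, so \<open>t - m\<close> is t / gcd(t, m), the
  usual generator of a colon ideal.\<close>

lemma monomial_colon:
  fixes p :: "('v, 'k::field) mpoly"
  shows "p * monom m \<in> ideal_gen (monom ` T) \<longleftrightarrow> p \<in> ideal_gen (monom ` (\<lambda>t. t - m) ` T)"
proof -
  have "mono_dvd t (m + s) \<longleftrightarrow> mono_dvd (t - m) s" for t s :: "'v mono"
    by (auto simp: mono_dvd_iff lookup_add lookup_minus le_diff_conv add.commute)
  then show ?thesis
    by (simp add: monomial_span_iff mult.commute[of p] keys_monom_mult)
qed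

lemma ideal_gen_insert:
  "ideal_gen (insert m S) = {b + c * m | b c. b \<in> ideal_gen S}"
  for m :: "('v, 'k::field) mpoly"
proof -
  have "ideal_gen (insert m S) = {x. \<exists>k. x - k * m \<in> ideal_gen S}"
    unfolding ideal_gen_def by (rule ring_module.span_insert)
  also have "\<dots> = {b + c * m | b c. b \<in> ideal_gen S}"
    by (auto simp: algebra_simps) (metis diff_add_cancel, metis add_diff_cancel)
  finally show ?thesis .
qed

section \<open>Graded complexes of free modules\<close>

text \<open>Row vector times matrix, the a-th row \<open>A a\<close> being the image of the a-th
  basis vector; maps therefore compose from left to right. Vectors are total functions on the
  naturals, so the length \<open>r\<close> has to be passed along.\<close>

definition rmul :: "nat \<Rightarrow> (nat \<Rightarrow> 'a::comm_ring_1) \<Rightarrow> (nat \<Rightarrow> nat \<Rightarrow> 'a) \<Rightarrow> nat \<Rightarrow> 'a" where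
  "rmul r x A = (\<lambda>b. \<Sum>a<r. x a * A a b)"

definition vec :: "nat \<Rightarrow> (nat \<Rightarrow> 'a::zero) \<Rightarrow> bool" where
  "vec r x \<longleftrightarrow> (\<forall>a\<ge>r. x a = 0)"

lemma rmul_assoc: "rmul s (rmul r x A) B = rmul r x (\<lambda>b. rmul s (A b) B)"
proof
  fix c
  have "(\<Sum>b<s. (\<Sum>a<r. x a * A a b) * B b c) = (\<Sum>b<s. \<Sum>a<r. x a * (A a b * B b c))"
    by (simp only: sum_distrib_right mult.assoc)
  also have "\<dots> = (\<Sum>a<r. \<Sum>b<s. x a * (A a b * B b c))"
    by (rule sum.swap)
  finally show "rmul s (rmul r x A) B c = rmul r x (\<lambda>b. rmul s (A b) B) c"
    unfolding rmul_def sum_distrib_left .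
qed

lemma rmul_0_left [simp]: "rmul r 0 A = 0"
  by (rule ext) (simp add: rmul_def)

lemma rmul_0_right [simp]: "rmul r x (\<lambda>_. 0) = 0" "rmul r x 0 = 0"
  by (rule ext, simp add: rmul_def)+

lemma rmul_1: "rmul (Suc 0) x A b = x 0 * A 0 b"
  by (simp add: rmul_def)

lemma rmul_add_left: "rmul r (x + y) A = rmul r x A + rmul r y A"
  by (rule ext) (simp add: rmul_def distrib_right sum.distrib)

lemma rmul_uminus_left: "rmul r (- x) A = - rmul r x A"
  by (rule ext) (simp add: rmul_def sum_negf)

lemma rmul_diff_left: "rmul r (x - y) A = rmul r x A - rmul r y A"
  by (rule ext) (simp add: rmul_def left_diff_distrib sum_subtractf)

lemma rmul_add_right: "rmul r x (\<lambda>a. A a + B a) = rmul r x A + rmul r x B"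
  by (rule ext) (simp add: rmul_def distrib_left sum.distrib)

lemma rmul_uminus_right: "rmul r x (\<lambda>a. - A a) = - rmul r x A"
  by (rule ext) (simp add: rmul_def sum_negf)

lemma rmul_diff_right: "rmul r x (\<lambda>a. A a - B a) = rmul r x A - rmul r x B"
  by (rule ext) (simp add: rmul_def right_diff_distrib sum_subtractf)

lemma rmul_cong: "(\<And>a. a < r \<Longrightarrow> A a = B a) \<Longrightarrow> rmul r x A = rmul r x B"
  by (rule ext) (simp add: rmul_def)

lemma vec_0 [simp]: "vec r 0" "vec r (\<lambda>_. 0)"
  by (simp_all add: vec_def)

lemma vec_rmul: "(\<And>a. vec s (A a)) \<Longrightarrow> vec s (rmul r x A)"
  by (simp add: vec_def rmul_def)

lemma vec_add: "vec r x \<Longrightarrow> vec r y \<Longrightarrow> vec r (x + y)"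
  for x :: "nat \<Rightarrow> 'a::comm_ring_1"
  by (simp add: vec_def)

lemma vec_diff: "vec r x \<Longrightarrow> vec r y \<Longrightarrow> vec r (x - y)"
  for x :: "nat \<Rightarrow> 'a::comm_ring_1"
  by (simp add: vec_def)

definition unit_vec :: "nat \<Rightarrow> nat \<Rightarrow> nat \<Rightarrow> 'a::comm_ring_1" where
  "unit_vec r a b = (if a = b \<and> a < r then 1 else 0)"

lemma vec_unit_vec [simp]: "vec r (unit_vec r a)"
  by (simp add: vec_def unit_vec_def)

lemma rmul_unit_vec: "rmul r (unit_vec r a) A = (if a < r then A a else 0)"
  by (auto simp: rmul_def unit_vec_def fun_eq_iff if_distrib[where f = "\<lambda>x. x * _"] cong: if_cong)

lemma rmul_unit_mat: "vec r x \<Longrightarrow> rmul r x (unit_vec r) = x"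
  by (auto simp: rmul_def unit_vec_def vec_def fun_eq_iff if_distrib cong: if_cong)

text \<open>\<open>mt i\<close> is the matrix of the differential from position i + 1 to position i,
  and \<open>dg i a\<close> the degree of the a-th basis vector in position i.\<close>

record 'a cx =
  rk :: "nat \<Rightarrow> nat"
  dg :: "nat \<Rightarrow> nat \<Rightarrow> int"
  mt :: "nat \<Rightarrow> nat \<Rightarrow> nat \<Rightarrow> 'a"

text \<open>Rows and entries beyond the ranks are required to vanish, so that identities between
  maps can be stated for all indices without range conditions.\<close>

definition graded_map ::
  "int \<Rightarrow> ('v, 'k::field) mpoly cx \<Rightarrow> nat \<Rightarrow> ('v, 'k) mpoly cx \<Rightarrow> nat
    \<Rightarrow> (nat \<Rightarrow> nat \<Rightarrow> ('v, 'k) mpoly) \<Rightarrow> bool" where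
  "graded_map e X n Y m f \<longleftrightarrow> (\<forall>a\<ge>rk X n. f a = 0) \<and> (\<forall>a. vec (rk Y m) (f a)) \<and>
     (\<forall>a b. homogeneous (f a b) (dg X n a + e - dg Y m b))"

lemma graded_mapD:
  assumes "graded_map e X n Y m f"
  shows "a \<ge> rk X n \<Longrightarrow> f a = 0" "vec (rk Y m) (f a)"
    "homogeneous (f a b) (dg X n a + e - dg Y m b)"
  using assms by (auto simp: graded_map_def)

lemma graded_map_comp:
  fixes f :: "nat \<Rightarrow> nat \<Rightarrow> ('v::finite, 'k::field) mpoly"
  assumes f: "graded_map e X n Y m f" and g: "graded_map e' Y m Z l g"
  shows "graded_map (e + e') X n Z l (\<lambda>a. rmul (rk Y m) (f a) g)"
  unfolding graded_map_def
proof (intro conjI allI impI)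
  fix a b
  show "homogeneous (rmul (rk Y m) (f a) g b) (dg X n a + (e + e') - dg Z l b)"
    unfolding rmul_def
  proof (rule homogeneous_sum)
    fix c
    show "homogeneous (f a c * g c b) (dg X n a + (e + e') - dg Z l b)"
      using homogeneous_mult[OF graded_mapD(3)[OF f] graded_mapD(3)[OF g], of a c c b]
      by (simp add: algebra_simps)
  qed
next
  fix a assume "rk X n \<le> a"
  then show "rmul (rk Y m) (f a) g = 0" using graded_mapD(1)[OF f] by simp
qed (use graded_mapD(2)[OF g] in \<open>rule vec_rmul\<close>)

lemma graded_map_diff:
  "graded_map e X n Y m f \<Longrightarrow> graded_map e X n Y m g \<Longrightarrow> graded_map e X n Y m (\<lambda>a. f a - g a)"
  unfolding graded_map_def by (auto intro: homogeneous_diff vec_diff)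

lemma graded_map_unit: "graded_map 0 X n X n (unit_vec (rk X n))"
proof -
  have "unit_vec r a = 0" if "a \<ge> r" for r a :: nat
    using that by (auto simp: unit_vec_def fun_eq_iff)
  then show ?thesis
    by (auto simp: graded_map_def) (simp add: unit_vec_def homogeneous_1)
qed

lemma graded_map_0: "graded_map e X n Y m (\<lambda>_. 0)"
  by (auto simp: graded_map_def)

text \<open>A factorization need not be graded; its components of the right degrees are one that is.\<close>

lemma graded_map_factor:
  fixes f :: "nat \<Rightarrow> nat \<Rightarrow> ('v::finite, 'k::field) mpoly"
  assumes f: "graded_map e X n Y m f" and g: "graded_map 0 Z l Y m g"
    and ex: "\<And>a. \<exists>y. f a = rmul (rk Z l) y g"
  shows "\<exists>h. graded_map e X n Z l h \<and> (\<forall>a. rmul (rk Z l) (h a) g = f a)"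
proof -
  obtain y where y: "\<And>a. f a = rmul (rk Z l) (y a) g" using ex by metis
  define h where "h a b = (if a < rk X n \<and> b < rk Z l
    then hom_comp (dg X n a + e - dg Z l b) (y a b) else 0)" for a b
  have h0: "h a = 0" if "a \<ge> rk X n" for a
    using that by (auto simp: h_def fun_eq_iff)
  have "rmul (rk Z l) (h a) g = f a" for a
  proof (cases "a < rk X n")
    case True
    have "rmul (rk Z l) (h a) g c = f a c" for c
    proof -
      let ?d = "dg X n a + e - dg Y m c"
      have "f a c = hom_comp ?d (f a c)"
        using graded_mapD(3)[OF f] by (simp add: hom_comp_homogeneous)
      also have "\<dots> = (\<Sum>b<rk Z l. hom_comp ?d (y a b * g b c))"
        by (simp add: y rmul_def hom_comp_sum)
      also have "\<dots> = (\<Sum>b<rk Z l. h a b * g b c)"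
      proof (intro sum.cong refl)
        fix b assume "b \<in> {..<rk Z l}"
        moreover have "?d - (dg Z l b + 0 - dg Y m c) = dg X n a + e - dg Z l b" by simp
        ultimately show "hom_comp ?d (y a b * g b c) = h a b * g b c"
          using True by (simp only: hom_comp_mult[OF graded_mapD(3)[OF g]] h_def) simp
      qed
      finally show ?thesis by (simp add: rmul_def)
    qed
    then show ?thesis by (rule ext)
  qed (use h0 graded_mapD(1)[OF f] in simp)
  moreover have "graded_map e X n Z l h"
    using h0 by (auto simp: graded_map_def vec_def) (auto simp: h_def)
  ultimately show ?thesis by blast
qed

definition graded_complex :: "('v, 'k::field) mpoly cx \<Rightarrow> bool" where
  "graded_complex X \<longleftrightarrow> (\<forall>i. graded_map 0 X (Suc i) X i (mt X i)) \<and>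
     (\<forall>i a. rmul (rk X (Suc i)) (mt X (Suc i) a) (mt X i) = 0)"

text \<open>\<open>X\<close> is a resolution of \<open>R / I\<close>, so its indices exceed those of a resolution of \<open>I\<close> by one.\<close>

definition resolves :: "('v, 'k::field) mpoly cx \<Rightarrow> ('v, 'k) mpoly set \<Rightarrow> bool" where
  "resolves X I \<longleftrightarrow> graded_complex X \<and> rk X 0 = 1 \<and> dg X 0 0 = 0 \<and>
     (\<forall>i x. vec (rk X (Suc i)) x \<and> rmul (rk X (Suc i)) x (mt X i) = 0 \<longrightarrow>
        (\<exists>y. x = rmul (rk X (Suc (Suc i))) y (mt X (Suc i)))) \<and>
     {rmul (rk X 1) y (mt X 0) 0 | y. True} = I"

lemma graded_complexD:
  assumes "graded_complex X"
  shows "graded_map 0 X (Suc i) X i (mt X i)" "rmul (rk X (Suc i)) (mt X (Suc i) a) (mt X i) = 0"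
  using assms by (auto simp: graded_complex_def)

lemma resolvesD:
  assumes "resolves X I"
  shows "graded_complex X" "rk X 0 = 1" "dg X 0 0 = 0"
    "vec (rk X (Suc i)) x \<Longrightarrow> rmul (rk X (Suc i)) x (mt X i) = 0 \<Longrightarrow>
       \<exists>y. x = rmul (rk X (Suc (Suc i))) y (mt X (Suc i))"
    "p \<in> I \<longleftrightarrow> (\<exists>y. p = rmul (rk X (Suc 0)) y (mt X 0) 0)"
    "graded_map 0 X (Suc i) X i (mt X i)" "rmul (rk X (Suc i)) (mt X (Suc i) a) (mt X i) = 0"
  using assms by (auto simp: resolves_def graded_complex_def)

section \<open>Chain maps: lifting and homotopy\<close>

definition chain_map ::
  "int \<Rightarrow> ('v, 'k::field) mpoly cx \<Rightarrow> ('v, 'k) mpoly cx \<Rightarrow> (nat \<Rightarrow> nat \<Rightarrow> nat \<Rightarrow> ('v, 'k) mpoly)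
    \<Rightarrow> bool" where
  "chain_map e X Y f \<longleftrightarrow> (\<forall>i. graded_map e X i Y i (f i)) \<and>
     (\<forall>i a. rmul (rk Y (Suc i)) (f (Suc i) a) (mt Y i) = rmul (rk X i) (mt X i a) (f i))"

lemma chain_mapD:
  assumes "chain_map e X Y f"
  shows "graded_map e X i Y i (f i)"
    "rmul (rk Y (Suc i)) (f (Suc i) a) (mt Y i) = rmul (rk X i) (mt X i a) (f i)"
  using assms by (auto simp: chain_map_def)

text \<open>The comparison theorem: exactness of \<open>Y\<close> lifts one position at a time, and
  \<open>graded_map_factor\<close> keeps the lifts graded. \<open>X\<close> is only assumed to be a
  complex because its modules are free anyway.\<close>

lemma chain_map_exists:
  fixes X Y :: "('v::finite, 'k::field) mpoly cx"
  assumes X: "graded_complex X" and Y: "resolves Y I" and f0: "graded_map e X 0 Y 0 f0"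
    and ex: "\<And>a. \<exists>y. rmul (rk X 0) (mt X 0 a) f0 = rmul (rk Y (Suc 0)) y (mt Y 0)"
  shows "\<exists>f. chain_map e X Y f \<and> f 0 = f0"
proof -
  \<comment> \<open>\<open>P\<close> carries the induction: besides being graded, the current map
    sends boundaries of \<open>X\<close> to boundaries of \<open>Y\<close>, so that the next square
    can be completed. \<open>Q\<close> says that this square commutes.\<close>
  define P where "P n f \<longleftrightarrow> graded_map e X n Y n f \<and> (n = 0 \<longrightarrow> f = f0) \<and>
    (\<forall>a. \<exists>y. rmul (rk X n) (mt X n a) f = rmul (rk Y (Suc n)) y (mt Y n))" for n f
  define Q where "Q n f f' \<longleftrightarrow>
    (\<forall>a. rmul (rk Y (Suc n)) (f' a) (mt Y n) = rmul (rk X n) (mt X n a) f)" for n f f'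
  have "\<exists>f. \<forall>n. P n (f n) \<and> Q n (f n) (f (Suc n))"
  proof (rule dependent_nat_choice)
    show "\<exists>f. P 0 f" using f0 ex by (auto simp: P_def)
    fix f n assume P: "P n f"
    have "graded_map (0 + e) X (Suc n) Y n (\<lambda>a. rmul (rk X n) (mt X n a) f)"
      using graded_map_comp graded_complexD(1)[OF X] P P_def by blast
    then obtain f' where f': "graded_map e X (Suc n) Y (Suc n) f'"
      "\<And>a. rmul (rk Y (Suc n)) (f' a) (mt Y n) = rmul (rk X n) (mt X n a) f"
      using graded_map_factor[OF _ resolvesD(6)[OF Y]] P unfolding P_def by fastforce
    have "\<exists>y. rmul (rk X (Suc n)) (mt X (Suc n) a) f' = rmul (rk Y (Suc (Suc n))) y (mt Y (Suc n))" for a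
    proof (rule resolvesD(4)[OF Y])
      show "vec (rk Y (Suc n)) (rmul (rk X (Suc n)) (mt X (Suc n) a) f')"
        by (rule vec_rmul) (rule graded_mapD(2)[OF f'(1)])
      show "rmul (rk Y (Suc n)) (rmul (rk X (Suc n)) (mt X (Suc n) a) f') (mt Y n) = 0"
        by (simp add: rmul_assoc f'(2)) (simp add: rmul_assoc[symmetric] graded_complexD(2)[OF X])
    qed
    with f' show "\<exists>f'. P (Suc n) f' \<and> Q n f f'" by (auto simp: P_def Q_def)
  qed
  then show ?thesis by (auto simp: P_def Q_def chain_map_def)
qed

lemma resolves_row_in_ideal:
  assumes "resolves X I"
  shows "mt X 0 a 0 \<in> I"
proof -
  have "mt X 0 a 0 = rmul (rk X (Suc 0)) (unit_vec (rk X (Suc 0)) a) (mt X 0) 0"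
    using graded_mapD(1)[OF resolvesD(6)[OF assms, of 0], of a] by (simp add: rmul_unit_vec)
  then show ?thesis using resolvesD(5)[OF assms] by blast
qed

definition scalar_mat :: "'a::zero \<Rightarrow> nat \<Rightarrow> nat \<Rightarrow> 'a" where
  "scalar_mat m a b = (if a = 0 \<and> b = 0 then m else 0)"

lemma scalar_mat_1: "scalar_mat 1 = unit_vec 1"
  by (auto simp: scalar_mat_def unit_vec_def fun_eq_iff)

text \<open>Multiplication by \<open>m\<close> induces a map from R / I to R / J. With
  \<open>m = 1\<close> it serves to compare two resolutions of one ideal; with a colon ideal for
  \<open>I\<close> it supplies the map of a mapping cone.\<close>

lemma mult_chain_map_exists:
  fixes X Y :: "('v::finite, 'k::field) mpoly cx"
  assumes X: "resolves X I" and Y: "resolves Y J" and m: "homogeneous m e"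
    and sub: "\<And>p. p \<in> I \<Longrightarrow> p * m \<in> J"
  shows "\<exists>f. chain_map e X Y f \<and> f 0 = scalar_mat m"
proof (rule chain_map_exists[OF resolvesD(1)[OF X] Y])
  show "graded_map e X 0 Y 0 (scalar_mat m)"
    using resolvesD(2,3)[OF X] resolvesD(2,3)[OF Y] m
    by (auto simp: graded_map_def scalar_mat_def fun_eq_iff vec_def)
  fix a
  have "mt X 0 a 0 \<in> I" by (rule resolves_row_in_ideal[OF X])
  then obtain y where y: "mt X 0 a 0 * m = rmul (rk Y (Suc 0)) y (mt Y 0) 0"
    using resolvesD(5)[OF Y] sub by blast
  have v: "vec 1 (rmul (rk Y (Suc 0)) y (mt Y 0))"
    using graded_mapD(2)[OF resolvesD(6)[OF Y, of 0]] resolvesD(2)[OF Y] by (intro vec_rmul) simp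
  have "rmul (rk X 0) (mt X 0 a) (scalar_mat m) b = rmul (rk Y (Suc 0)) y (mt Y 0) b" for b
  proof (cases "b = 0")
    case True
    then show ?thesis
      using y by (simp add: rmul_1 scalar_mat_def resolvesD(2)[OF X])
  next
    case False
    then show ?thesis
      using v by (simp add: rmul_1 scalar_mat_def vec_def resolvesD(2)[OF X])
  qed
  then show "\<exists>y. rmul (rk X 0) (mt X 0 a) (scalar_mat m) = rmul (rk Y (Suc 0)) y (mt Y 0)"
    by (auto intro: ext)
qed

lemma chain_map_null_homotopic:
  fixes X Y :: "('v::finite, 'k::field) mpoly cx"
  assumes X: "graded_complex X" and Y: "resolves Y I" and f: "chain_map e X Y f" "f 0 = (\<lambda>_. 0)"
  shows "\<exists>h. \<forall>i. graded_map e X i Y (Suc i) (h i) \<and>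
    (\<forall>a. f (Suc i) a = rmul (rk Y (Suc (Suc i))) (h (Suc i) a) (mt Y (Suc i)) + rmul (rk X i) (mt X i a) (h i))"
proof -
  define P where "P n h \<longleftrightarrow> graded_map e X n Y (Suc n) h \<and>
    (\<forall>a. rmul (rk Y (Suc n)) (f (Suc n) a - rmul (rk X n) (mt X n a) h) (mt Y n) = 0)" for n h
  define Q where "Q n h h' \<longleftrightarrow> (\<forall>a. f (Suc n) a - rmul (rk X n) (mt X n a) h =
    rmul (rk Y (Suc (Suc n))) (h' a) (mt Y (Suc n)))" for n h h'
  have "\<exists>h. \<forall>n. P n (h n) \<and> Q n (h n) (h (Suc n))"
  proof (rule dependent_nat_choice)
    have "P 0 (\<lambda>_. 0)"
      using graded_map_0 chain_mapD(2)[OF f(1), of 0] f(2) by (simp add: P_def)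
    then show "\<exists>h. P 0 h" by blast
    fix h n assume P: "P n h"
    \<comment> \<open>What the homotopy found so far leaves of \<open>f (Suc n)\<close>. By
      \<open>P\<close> its rows are cycles, so exactness of \<open>Y\<close> factors it through the
      next differential, and the factor is the next \<open>h'\<close>.\<close>
    define w where "w = (\<lambda>a. f (Suc n) a - rmul (rk X n) (mt X n a) h)"
    have "graded_map (0 + e) X (Suc n) Y (Suc n) (\<lambda>a. rmul (rk X n) (mt X n a) h)"
      using graded_map_comp graded_complexD(1)[OF X] P P_def by blast
    then have w: "graded_map e X (Suc n) Y (Suc n) w"
      unfolding w_def using graded_map_diff chain_mapD(1)[OF f(1)] by fastforce
    have "\<exists>y. w a = rmul (rk Y (Suc (Suc n))) y (mt Y (Suc n))" for a
      using resolvesD(4)[OF Y graded_mapD(2)[OF w]] P by (simp add: w_def P_def)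
    then obtain h' where h': "graded_map e X (Suc n) Y (Suc (Suc n)) h'"
      "\<And>a. rmul (rk Y (Suc (Suc n))) (h' a) (mt Y (Suc n)) = w a"
      using graded_map_factor[OF w resolvesD(6)[OF Y]] by blast
    have "rmul (rk Y (Suc (Suc n))) (f (Suc (Suc n)) a - rmul (rk X (Suc n)) (mt X (Suc n) a) h') (mt Y (Suc n)) = 0" for a
      by (simp only: rmul_diff_left chain_mapD(2)[OF f(1)] rmul_assoc h'(2))
        (simp only: w_def rmul_diff_right rmul_assoc[symmetric] graded_complexD(2)[OF X], simp)
    with h' show "\<exists>h'. P (Suc n) h' \<and> Q n h h'" by (auto simp: P_def Q_def w_def)
  qed
  then obtain h where "\<forall>n. P n (h n) \<and> Q n (h n) (h (Suc n))" by blast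
  then show ?thesis unfolding P_def Q_def by (metis diff_add_cancel)
qed

section \<open>Reduction modulo the variables\<close>

definition red :: "(nat \<Rightarrow> nat \<Rightarrow> ('v, 'k::field) mpoly) \<Rightarrow> nat \<Rightarrow> nat \<Rightarrow> 'k" where
  "red A a b = const_term (A a b)"

definition cycle :: "('v, 'k::field) mpoly cx \<Rightarrow> nat \<Rightarrow> int \<Rightarrow> (nat \<Rightarrow> 'k) \<Rightarrow> bool" where
  "cycle X i j c \<longleftrightarrow> vec (rk X i) c \<and> (\<forall>a. c a \<noteq> 0 \<longrightarrow> dg X i a = j) \<and>
     (\<forall>l. i = Suc l \<longrightarrow> rmul (rk X i) c (red (mt X l)) = 0)"

definition boundary :: "('v, 'k::field) mpoly cx \<Rightarrow> nat \<Rightarrow> int \<Rightarrow> (nat \<Rightarrow> 'k) \<Rightarrow> bool" where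
  "boundary X i j c \<longleftrightarrow> (\<exists>d. (\<forall>a. d a \<noteq> 0 \<longrightarrow> dg X (Suc i) a = j) \<and>
     c = rmul (rk X (Suc i)) d (red (mt X i)))"

text \<open>For a resolution of R / I these are the pairs with Tor_i(R / I, k)_j nonzero; no
  dimension is recorded.\<close>

definition tor_support :: "('v, 'k::field) mpoly cx \<Rightarrow> (nat \<times> int) set" where
  "tor_support X = {(i, j). \<exists>c. cycle X i j c \<and> \<not> boundary X i j c}"

lemma red_rmul: "red (\<lambda>a. rmul r (A a) B) = (\<lambda>a. rmul r (red A a) (red B))"
  by (simp add: red_def rmul_def fun_eq_iff lookup_sum const_term_mult)

lemma red_add: "red (\<lambda>a. A a + B a) = (\<lambda>a. red A a + red B a)"
  by (simp add: red_def fun_eq_iff lookup_add)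

lemma red_diff: "red (\<lambda>a. A a - B a) = (\<lambda>a. red A a - red B a)"
  by (simp add: red_def fun_eq_iff lookup_minus)

lemma red_0: "red (\<lambda>_. 0) = (\<lambda>_. 0)"
  by (simp add: red_def fun_eq_iff)

lemma red_unit_vec: "red (unit_vec r) = unit_vec r"
  by (simp add: red_def unit_vec_def fun_eq_iff)

lemma vec_red: "graded_map e X n Y m f \<Longrightarrow> vec (rk Y m) (red f a)"
  by (auto simp: graded_map_def vec_def red_def)

lemma red_degree:
  assumes "graded_map e X n Y m f" "\<And>a. c a \<noteq> 0 \<Longrightarrow> dg X n a = j" "rmul r c (red f) b \<noteq> 0"
  shows "dg Y m b = j + e"
proof -
  obtain a where "c a * red f a b \<noteq> 0"
    using assms(3) unfolding rmul_def by (meson sum.neutral)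
  then show ?thesis
    using assms(2) const_term_homogeneous[OF graded_mapD(3)[OF assms(1)]] by (fastforce simp: red_def)
qed

text \<open>Comparison maps in both directions lift the identity of R / I, and their composite is
  homotopic to the identity of \<open>X\<close>. So \<open>f\<close> is injective on the reduced
  homology, which gives one inclusion; the other follows by exchanging \<open>X\<close> and
  \<open>Y\<close>.\<close>

lemma tor_support_mono:
  fixes X Y :: "('v::finite, 'k::field) mpoly cx"
  assumes X: "resolves X I" and Y: "resolves Y I"
  shows "tor_support X \<subseteq> tor_support Y"
proof -
  obtain f where f: "chain_map 0 X Y f" "f 0 = scalar_mat 1"
    using mult_chain_map_exists[OF X Y homogeneous_1] by auto
  obtain g where g: "chain_map 0 Y X g" "g 0 = scalar_mat 1"
    using mult_chain_map_exists[OF Y X homogeneous_1] by auto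
  note fD = chain_mapD[OF f(1)] and gD = chain_mapD[OF g(1)]
  \<comment> \<open>The chain map g f - 1 from \<open>X\<close> to itself. It vanishes in position
    0, where both lifts are the identity, hence is null-homotopic.\<close>
  define \<phi> where "\<phi> i a = rmul (rk Y i) (f i a) (g i) - unit_vec (rk X i) a" for i a
  have \<phi>_eq: "\<phi> i = (\<lambda>a. rmul (rk Y i) (f i a) (g i) - unit_vec (rk X i) a)" for i
    by (rule ext) (simp only: \<phi>_def)
  have \<phi>map: "graded_map 0 X i X i (\<phi> i)" for i
    unfolding \<phi>_eq
    using graded_map_diff[OF graded_map_comp[OF fD(1) gD(1), simplified] graded_map_unit] .
  have \<phi>0: "\<phi> 0 = (\<lambda>_. 0)"
    by (rule ext) (simp add: \<phi>_def f(2) g(2) resolvesD(2)[OF X] resolvesD(2)[OF Y] scalar_mat_1 rmul_unit_mat del: One_nat_def)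
  have \<phi>_chain: "chain_map 0 X X \<phi>"
    unfolding chain_map_def
  proof (intro conjI allI \<phi>map)
    fix i a
    have m: "(if a < rk X (Suc i) then mt X i a else 0) = mt X i a"
      using graded_mapD(1)[OF resolvesD(6)[OF X]] by auto
    have "rmul (rk X (Suc i)) (\<phi> (Suc i) a) (mt X i)
      = rmul (rk Y (Suc i)) (f (Suc i) a) (\<lambda>b. rmul (rk X (Suc i)) (g (Suc i) b) (mt X i)) - mt X i a"
      by (simp only: \<phi>_def rmul_diff_left rmul_assoc rmul_unit_vec m)
    also have "\<dots> = rmul (rk X i) (mt X i a) (\<lambda>b. rmul (rk Y i) (f i b) (g i)) - mt X i a"
      by (simp only: gD(2)) (simp only: rmul_assoc[symmetric] fD(2))
    also have "\<dots> = rmul (rk X i) (mt X i a) (\<phi> i)"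
      by (simp only: \<phi>_eq rmul_diff_right rmul_unit_mat[OF graded_mapD(2)[OF resolvesD(6)[OF X]]])
    finally show "rmul (rk X (Suc i)) (\<phi> (Suc i) a) (mt X i) = rmul (rk X i) (mt X i a) (\<phi> i)" .
  qed
  obtain h where h: "\<And>i. graded_map 0 X i X (Suc i) (h i)"
    "\<And>i a. \<phi> (Suc i) a = rmul (rk X (Suc (Suc i))) (h (Suc i) a) (mt X (Suc i)) + rmul (rk X i) (mt X i a) (h i)"
    using chain_map_null_homotopic[OF resolvesD(1)[OF X] X \<phi>_chain \<phi>0] by blast
  have red_comm: "rmul (rk Y (Suc i)) (red (f (Suc i)) a) (red (mt Y i)) = rmul (rk X i) (red (mt X i) a) (red (f i))"
    for i a
  proof -
    have "red (\<lambda>a. rmul (rk Y (Suc i)) (f (Suc i) a) (mt Y i)) = red (\<lambda>a. rmul (rk X i) (mt X i a) (f i))"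
      by (simp only: fD(2))
    then show ?thesis unfolding red_rmul by (rule fun_cong)
  qed
  have red_comm': "rmul (rk X (Suc i)) (red (g (Suc i)) a) (red (mt X i)) = rmul (rk Y i) (red (mt Y i) a) (red (g i))"
    for i a
  proof -
    have "red (\<lambda>a. rmul (rk X (Suc i)) (g (Suc i) a) (mt X i)) = red (\<lambda>a. rmul (rk Y i) (mt Y i a) (g i))"
      by (simp only: gD(2))
    then show ?thesis unfolding red_rmul by (rule fun_cong)
  qed
  have red_\<phi>: "red (\<phi> i) = (\<lambda>a. rmul (rk Y i) (red (f i) a) (red (g i)) - unit_vec (rk X i) a)" for i
    unfolding \<phi>_eq by (simp only: red_diff red_rmul red_unit_vec)
  \<comment> \<open>If the image of \<open>c\<close> under \<open>f\<close> is a boundary, so is its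
    image under the composite, and that differs from \<open>c\<close> by a boundary.\<close>
  have key: "boundary X i j c"
    if c: "cycle X i j c" and b: "boundary Y i j (rmul (rk X i) c (red (f i)))" for i j c
  proof -
    have cv: "vec (rk X i) c" and cd: "\<And>a. c a \<noteq> 0 \<Longrightarrow> dg X i a = j"
      and cz: "\<And>l. i = Suc l \<Longrightarrow> rmul (rk X i) c (red (mt X l)) = 0"
      using c by (auto simp: cycle_def)
    obtain d where d: "\<And>a. d a \<noteq> 0 \<Longrightarrow> dg Y (Suc i) a = j"
      "rmul (rk X i) c (red (f i)) = rmul (rk Y (Suc i)) d (red (mt Y i))"
      using b by (auto simp: boundary_def)
    define d1 where "d1 = rmul (rk Y (Suc i)) d (red (g (Suc i)))"
    have "rmul (rk Y i) (rmul (rk X i) c (red (f i))) (red (g i)) = rmul (rk X (Suc i)) d1 (red (mt X i))"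
      unfolding d1_def d(2) by (simp only: rmul_assoc red_comm')
    moreover have "rmul (rk X i) c (red (\<phi> i)) = rmul (rk Y i) (rmul (rk X i) c (red (f i))) (red (g i)) - c"
      by (simp only: red_\<phi> rmul_diff_right rmul_assoc rmul_unit_mat[OF cv])
    ultimately have c1: "rmul (rk X (Suc i)) d1 (red (mt X i)) - rmul (rk X i) c (red (\<phi> i)) = c"
      by simp
    have d1: "dg X (Suc i) a = j" if "d1 a \<noteq> 0" for a
      using red_degree[OF gD(1), of d "Suc i" j _ a] d(1) that by (simp add: d1_def)
    \<comment> \<open>In position 0, \<open>\<phi>\<close> is 0 and \<open>d1\<close> already bounds
      \<open>c\<close>. Elsewhere the homotopy contributes the boundary of \<open>d2\<close> and a
      term that factors through the differential of \<open>c\<close>, which is 0 as \<open>c\<close>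
      is a cycle.\<close>
    show ?thesis
    proof (cases i)
      case 0
      then have "c = rmul (rk X (Suc i)) d1 (red (mt X i))"
        using c1 by (simp add: \<phi>0 red_0)
      then show ?thesis using d1 unfolding boundary_def by blast
    next
      case (Suc l)
      define d2 where "d2 = rmul (rk X i) c (red (h i))"
      have d2: "dg X (Suc i) a = j" if "d2 a \<noteq> 0" for a
        using red_degree[OF h(1), of c "i" j _ a] cd that by (simp add: d2_def)
      have "\<phi> i = (\<lambda>a. rmul (rk X (Suc i)) (h i a) (mt X i) + rmul (rk X l) (mt X l a) (h l))"
        using h(2) by (simp add: Suc fun_eq_iff)
      then have "red (\<phi> i) = (\<lambda>a. rmul (rk X (Suc i)) (red (h i) a) (red (mt X i))
          + rmul (rk X l) (red (mt X l) a) (red (h l)))"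
        by (simp only: red_add red_rmul)
      then have "rmul (rk X i) c (red (\<phi> i)) = rmul (rk X (Suc i)) d2 (red (mt X i))
          + rmul (rk X l) (rmul (rk X i) c (red (mt X l))) (red (h l))"
        by (simp only: rmul_add_right rmul_assoc d2_def)
      then have "rmul (rk X i) c (red (\<phi> i)) = rmul (rk X (Suc i)) d2 (red (mt X i))"
        by (simp only: cz[OF Suc] rmul_0_left add_0_right)
      then have "c = rmul (rk X (Suc i)) (d1 - d2) (red (mt X i))"
        using c1 by (simp only: rmul_diff_left)
      moreover have "dg X (Suc i) a = j" if "(d1 - d2) a \<noteq> 0" for a
        using d1[of a] d2[of a] that by (cases "d1 a = 0") auto
      ultimately show ?thesis unfolding boundary_def by blast
    qed
  qed
  have "cycle Y i j (rmul (rk X i) c (red (f i)))" if c: "cycle X i j c" for i j c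
    unfolding cycle_def
  proof (intro conjI allI impI)
    show "vec (rk Y i) (rmul (rk X i) c (red (f i)))"
      using vec_red[OF fD(1)] by (intro vec_rmul)
    show "dg Y i a = j" if "rmul (rk X i) c (red (f i)) a \<noteq> 0" for a
      using red_degree[OF fD(1), of c i j _ a] c that by (auto simp: cycle_def)
    fix l assume l: "i = Suc l"
    then have "rmul (rk X i) c (red (mt X l)) = 0" using c by (auto simp: cycle_def)
    then have "rmul (rk X l) (rmul (rk X i) c (red (mt X l))) (red (f l)) = 0" by simp
    then show "rmul (rk Y i) (rmul (rk X i) c (red (f i))) (red (mt Y l)) = 0"
      by (simp only: rmul_assoc l red_comm)
  qed
  with key show ?thesis unfolding tor_support_def by blast
qed

lemma tor_support_unique:
  fixes X Y :: "('v::finite, 'k::field) mpoly cx"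
  shows "resolves X I \<Longrightarrow> resolves Y I \<Longrightarrow> tor_support X = tor_support Y"
  using tor_support_mono by blast

section \<open>Mapping cones\<close>

text \<open>Concatenation with a first block of length \<open>r\<close>. The same operation serves
  for vectors, for lists of degrees and for stacking the rows of matrices.\<close>

definition cat :: "nat \<Rightarrow> (nat \<Rightarrow> 'a) \<Rightarrow> (nat \<Rightarrow> 'a) \<Rightarrow> nat \<Rightarrow> 'a" where
  "cat r x y a = (if a < r then x a else y (a - r))"

lemma sum_lessThan_add: "(\<Sum>a<r + s. f a) = (\<Sum>a<r. f a) + (\<Sum>a<s. f (r + a))"
  for f :: "nat \<Rightarrow> 'a::comm_monoid_add"
  by (induction s) (simp_all add: add.assoc)

lemma rmul_cat: "rmul (r + s) (cat r x y) (cat r A B) = rmul r x A + rmul s y B"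
  by (rule ext) (simp add: rmul_def sum_lessThan_add cat_def)

lemma rmul_cat_right: "rmul s y (\<lambda>a. cat r (A a) (B a)) = cat r (rmul s y A) (rmul s y B)"
  by (rule ext) (simp add: rmul_def cat_def)

lemma cat_add: "cat r x y + cat r x' y' = cat r (x + x') (y + y')"
  by (rule ext) (simp add: cat_def)

lemma cat_0_right: "vec r x \<Longrightarrow> cat r x 0 = x"
  by (rule ext) (simp add: cat_def vec_def)

lemma cat_0: "cat r 0 0 = 0"
  by (rule ext) (simp add: cat_def)

lemma cat_inject:
  assumes "vec r x" "vec r x'" "cat r x y = cat r x' y'"
  shows "x = x'" "y = y'"
proof -
  have *: "cat r x y a = cat r x' y' a" for a using assms(3) by simp
  show "x = x'"
  proof
    fix a show "x a = x' a"
      using *[of a] assms(1,2) by (cases "a < r") (auto simp: cat_def vec_def)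
  qed
  show "y = y'"
  proof
    fix a show "y a = y' a" using *[of "r + a"] by (simp add: cat_def)
  qed
qed

lemma cat_cases:
  fixes x :: "nat \<Rightarrow> 'a::comm_ring_1"
  obtains y z where "vec r y" "x = cat r y z"
proof
  show "vec r (\<lambda>a. if a < r then x a else 0)" by (simp add: vec_def)
  show "x = cat r (\<lambda>a. if a < r then x a else 0) (\<lambda>a. x (r + a))"
    by (rule ext) (simp add: cat_def)
qed

lemma vec_cat_iff: "vec (r + s) (cat r x y) \<longleftrightarrow> vec s y"
proof -
  have "(\<forall>a\<ge>r + s. y (a - r) = 0) \<longleftrightarrow> (\<forall>a\<ge>s. y a = 0)"
    by (metis add_diff_cancel_left' diff_add_inverse nat_add_left_cancel_le add.commute le_add_diff_inverse le_diff_conv2 add_leD1)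
  then show ?thesis by (auto simp: vec_def cat_def)
qed

text \<open>Multiplication by a block triangular matrix with upper rows (A, 0) and lower rows (B,
  C); the zero block is implicit in the support of the rows of \<open>A\<close>.\<close>

lemma rmul_block:
  assumes "\<And>a. vec r (A a)"
  shows "rmul (r' + s) (cat r' x y) (cat r' A (\<lambda>a. cat r (B a) (C a))) =
    cat r (rmul r' x A + rmul s y B) (rmul s y C)"
proof -
  have "rmul r' x A = cat r (rmul r' x A) 0"
    by (simp add: cat_0_right vec_rmul assms)
  then have "rmul r' x A + cat r U V = cat r (rmul r' x A + U) V" for U V
    using cat_add[of r "rmul r' x A" 0 U V] by simp
  then show ?thesis by (simp add: rmul_cat rmul_cat_right)
qed

lemma red_cat: "red (cat r A B) = cat r (red A) (red B)"
  by (rule ext)+ (simp add: red_def cat_def)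

lemma red_cat_right: "red (\<lambda>a. cat r (A a) (B a)) = (\<lambda>a. cat r (red A a) (red B a))"
  by (rule ext)+ (simp add: red_def cat_def)

lemma red_uminus: "red (\<lambda>a. - A a) = (\<lambda>a. - red A a)"
  by (rule ext)+ (simp add: red_def)

text \<open>Position l + 1 is X_(l+1) plus P_l shifted by \<open>e\<close>, with differential (x, y)
  to (d x + f y, - d y); the sign makes the two composites of \<open>f\<close> with the
  differentials cancel. Position 0 is X_0 alone, so the cone again starts with R.\<close>

definition cone ::
  "int \<Rightarrow> (nat \<Rightarrow> nat \<Rightarrow> nat \<Rightarrow> ('v, 'k::field) mpoly) \<Rightarrow> ('v, 'k) mpoly cx \<Rightarrow> ('v, 'k) mpoly cx
    \<Rightarrow> ('v, 'k) mpoly cx" where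
  "cone e f P X =
    \<lparr>rk = (\<lambda>i. case i of 0 \<Rightarrow> rk X 0 | Suc l \<Rightarrow> rk X (Suc l) + rk P l),
     dg = (\<lambda>i. case i of 0 \<Rightarrow> dg X 0
       | Suc l \<Rightarrow> cat (rk X (Suc l)) (dg X (Suc l)) (\<lambda>a. dg P l a + e)),
     mt = (\<lambda>i. case i of 0 \<Rightarrow> cat (rk X (Suc 0)) (mt X 0) (f 0)
       | Suc l \<Rightarrow> cat (rk X (Suc (Suc l))) (mt X (Suc l))
           (\<lambda>a. cat (rk X (Suc l)) (f (Suc l) a) (- mt P l a)))\<rparr>"

lemma cone_simps:
  "rk (cone e f P X) 0 = rk X 0"
  "rk (cone e f P X) (Suc l) = rk X (Suc l) + rk P l"
  "dg (cone e f P X) 0 = dg X 0"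
  "dg (cone e f P X) (Suc l) = cat (rk X (Suc l)) (dg X (Suc l)) (\<lambda>a. dg P l a + e)"
  "mt (cone e f P X) 0 = cat (rk X (Suc 0)) (mt X 0) (f 0)"
  "mt (cone e f P X) (Suc l) = cat (rk X (Suc (Suc l))) (mt X (Suc l))
     (\<lambda>a. cat (rk X (Suc l)) (f (Suc l) a) (- mt P l a))"
  by (simp_all add: cone_def)

lemma rmul_cone_0:
  "rmul (rk (cone e f P X) (Suc 0)) (cat (rk X (Suc 0)) x y) (mt (cone e f P X) 0) =
     rmul (rk X (Suc 0)) x (mt X 0) + rmul (rk P 0) y (f 0)"
  by (simp add: cone_simps rmul_cat)

lemma rmul_cone_Suc:
  assumes "graded_complex X"
  shows "rmul (rk (cone e f P X) (Suc (Suc l))) (cat (rk X (Suc (Suc l))) x y) (mt (cone e f P X) (Suc l)) =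
    cat (rk X (Suc l)) (rmul (rk X (Suc (Suc l))) x (mt X (Suc l)) + rmul (rk P (Suc l)) y (f (Suc l)))
      (- rmul (rk P (Suc l)) y (mt P l))"
  using rmul_block[OF graded_mapD(2)[OF graded_complexD(1)[OF assms]]]
  by (simp add: cone_simps rmul_uminus_right)

lemma rmul_red_cone_0:
  "rmul (rk (cone e f P X) (Suc 0)) (cat (rk X (Suc 0)) x y) (red (mt (cone e f P X) 0)) =
     rmul (rk X (Suc 0)) x (red (mt X 0)) + rmul (rk P 0) y (red (f 0))"
  by (simp add: cone_simps rmul_cat red_cat)

lemma rmul_red_cone_Suc:
  assumes "graded_complex X"
  shows "rmul (rk (cone e f P X) (Suc (Suc l))) (cat (rk X (Suc (Suc l))) x y) (red (mt (cone e f P X) (Suc l))) =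
    cat (rk X (Suc l)) (rmul (rk X (Suc (Suc l))) x (red (mt X (Suc l))) + rmul (rk P (Suc l)) y (red (f (Suc l))))
      (- rmul (rk P (Suc l)) y (red (mt P l)))"
  using rmul_block[OF vec_red[OF graded_complexD(1)[OF assms]]]
  by (simp add: cone_simps red_cat red_cat_right red_uminus rmul_uminus_right)

lemma graded_complex_cone:
  fixes P X :: "('v::finite, 'k::field) mpoly cx"
  assumes P: "graded_complex P" and X: "graded_complex X" and f: "chain_map e P X f"
  shows "graded_complex (cone e f P X)"
  unfolding graded_complex_def
proof (intro conjI allI)
  note XD = graded_mapD[OF graded_complexD(1)[OF X]]
  note PD = graded_mapD[OF graded_complexD(1)[OF P]]
  note fD = graded_mapD[OF chain_mapD(1)[OF f]]
  let ?C = "cone e f P X"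
  fix i
  show "graded_map 0 ?C (Suc i) ?C i (mt ?C i)"
  proof (cases i)
    case 0
    have "homogeneous (mt ?C 0 a b) (dg ?C (Suc 0) a + 0 - dg ?C 0 b)" for a b
      using XD(3)[of 0 a b] fD(3)[of 0 "a - rk X (Suc 0)" b] by (simp add: cone_simps cat_def)
    moreover have "mt ?C 0 a = 0" if "a \<ge> rk ?C (Suc 0)" for a
      using that fD(1)[of 0 "a - rk X (Suc 0)"] by (simp add: cone_simps cat_def)
    moreover have "vec (rk ?C 0) (mt ?C 0 a)" for a
      using XD(2)[of 0 a] fD(2)[of 0] by (simp add: cone_simps cat_def)
    ultimately show ?thesis by (simp add: graded_map_def 0)
  next
    case (Suc l)
    let ?r = "rk X (Suc (Suc l))"
    have "homogeneous (mt ?C i a b) (dg ?C (Suc i) a + 0 - dg ?C i b)" for a b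
    proof (cases "a < ?r")
      case True
      then show ?thesis using XD(3)[of "Suc l" a b] XD(2)[of "Suc l" a]
        by (auto simp: cone_simps cat_def Suc vec_def)
    next
      case False
      then show ?thesis using fD(3)[of "Suc l" "a - ?r" b] PD(3)[of l "a - ?r" "b - rk X (Suc l)"]
        by (auto simp: cone_simps cat_def Suc intro: homogeneous_uminus)
    qed
    moreover have "mt ?C i a = 0" if "a \<ge> rk ?C (Suc i)" for a
      using that fD(1)[of "Suc l" "a - ?r"] PD(1)[of l "a - ?r"]
      by (simp add: cone_simps Suc cat_def[of ?r] cat_0)
    moreover have "vec (rk ?C i) (mt ?C i a)" for a
      using XD(2)[of "Suc l" a] PD(2)[of l "a - ?r"]
      by (auto simp: cone_simps Suc cat_def[of ?r] vec_cat_iff) (simp_all add: vec_def)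
    ultimately show ?thesis by (simp add: graded_map_def)
  qed
  fix a
  let ?r = "rk X (Suc (Suc i))"
  show "rmul (rk ?C (Suc i)) (mt ?C (Suc i) a) (mt ?C i) = 0"
  proof (cases "a < ?r")
    case True
    then have a: "mt ?C (Suc i) a = cat (rk X (Suc i)) (mt X (Suc i) a) 0"
      using XD(2)[of "Suc i" a] by (simp add: cone_simps cat_def[of ?r] cat_0_right)
    show ?thesis
    proof (cases i)
      case 0
      then show ?thesis unfolding a by (simp add: rmul_cone_0 graded_complexD(2)[OF X])
    next
      case (Suc l)
      then show ?thesis unfolding a
        by (simp add: rmul_cone_Suc[OF X] graded_complexD(2)[OF X] cat_0)
    qed
  next
    case False
    define b where "b = a - ?r"
    have a: "mt ?C (Suc i) a = cat (rk X (Suc i)) (f (Suc i) b) (- mt P i b)"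
      using False by (simp add: cone_simps cat_def[of ?r] b_def)
    show ?thesis
    proof (cases i)
      case 0
      then show ?thesis unfolding a
        by (simp add: rmul_cone_0 rmul_uminus_left chain_mapD(2)[OF f])
    next
      case (Suc l)
      then show ?thesis unfolding a
        by (simp add: rmul_cone_Suc[OF X] rmul_uminus_left chain_mapD(2)[OF f] graded_complexD(2)[OF P] cat_0)
    qed
  qed
qed

text \<open>Hypothesis \<open>L\<close> says that multiplication by \<open>m\<close> is injective
  from R / L to R / M. Injectivity is what makes the cone exact in positive positions, and the
  cokernel is R / (M + (m)).\<close>

lemma resolves_cone:
  fixes P X :: "('v::finite, 'k::field) mpoly cx"
  assumes P: "resolves P L" and X: "resolves X M" and f: "chain_map e P X f" "f 0 0 0 = m"
    and L: "\<And>p. p * m \<in> M \<Longrightarrow> p \<in> L"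
  shows "resolves (cone e f P X) {b + c * m | b c. b \<in> M}"
  unfolding resolves_def
proof (intro conjI allI impI)
  let ?C = "cone e f P X"
  note Xc = resolvesD(1)[OF X]
  show "graded_complex ?C" using graded_complex_cone f(1) resolvesD(1) P X by blast
  show "rk ?C 0 = 1" "dg ?C 0 0 = 0" using resolvesD(2,3)[OF X] by (simp_all add: cone_simps)
  have f0: "rmul (rk P 0) y (f 0) 0 = y 0 * m" for y
    by (simp add: rmul_def resolvesD(2)[OF P] f(2))
  show "{rmul (rk ?C 1) y (mt ?C 0) 0 | y. True} = {b + c * m | b c. b \<in> M}"
  proof (intro equalityI subsetI)
    fix p assume "p \<in> {rmul (rk ?C 1) y (mt ?C 0) 0 | y. True}"
    then obtain w where w: "p = rmul (rk ?C (Suc 0)) w (mt ?C 0) 0" by auto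
    obtain x y where "w = cat (rk X (Suc 0)) x y" using cat_cases by blast
    then have "p = rmul (rk X (Suc 0)) x (mt X 0) 0 + y 0 * m"
      by (simp add: w rmul_cone_0 f0)
    then show "p \<in> {b + c * m | b c. b \<in> M}" using resolvesD(5)[OF X] by blast
  next
    fix p assume "p \<in> {b + c * m | b c. b \<in> M}"
    then obtain b c where "p = b + c * m" "b \<in> M" by blast
    moreover from this(2) obtain x where "b = rmul (rk X (Suc 0)) x (mt X 0) 0"
      using resolvesD(5)[OF X] by blast
    ultimately have "p = rmul (rk X (Suc 0)) x (mt X 0) 0 + c * m" by simp
    then have "p = rmul (rk ?C (Suc 0)) (cat (rk X (Suc 0)) x (\<lambda>_. c)) (mt ?C 0) 0"
      by (simp add: rmul_cone_0 f0)
    then show "p \<in> {rmul (rk ?C 1) y (mt ?C 0) 0 | y. True}" by auto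
  qed
  fix i w assume w: "vec (rk ?C (Suc i)) w \<and> rmul (rk ?C (Suc i)) w (mt ?C i) = 0"
  obtain x y where xy: "vec (rk X (Suc i)) x" "w = cat (rk X (Suc i)) x y" using cat_cases by blast
  have yv: "vec (rk P i) y" using w by (simp add: xy(2) cone_simps vec_cat_iff)
  have *: "rmul (rk X (Suc i)) x (mt X i) + rmul (rk P i) y (f i) = 0 \<and>
      (\<exists>y1. y = rmul (rk P (Suc i)) y1 (mt P i))"
  proof (cases i)
    case 0
    then have 1: "rmul (rk X (Suc i)) x (mt X i) + rmul (rk P i) y (f i) = 0"
      using w by (simp add: xy(2) rmul_cone_0)
    then have "(rmul (rk X (Suc i)) x (mt X i) + rmul (rk P i) y (f i)) 0 = 0" by simp
    \<comment> \<open>In position 0 there is no differential of \<open>P\<close> to make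
      \<open>y\<close> a cycle. Instead \<open>y 0 * m\<close> lies in \<open>M\<close>, so
      \<open>L\<close> puts \<open>y 0\<close> into the image of \<open>mt P 0\<close>.\<close>
    then have "y 0 * m = rmul (rk X (Suc 0)) (- x) (mt X 0) 0"
      by (simp add: 0 f0 rmul_uminus_left eq_neg_iff_add_eq_0 add.commute)
    then have "y 0 \<in> L" using resolvesD(5)[OF X] L by blast
    then obtain y1 where y1: "y 0 = rmul (rk P (Suc 0)) y1 (mt P 0) 0" using resolvesD(5)[OF P] by blast
    have "vec 1 (rmul (rk P (Suc 0)) y1 (mt P 0))"
      using graded_mapD(2)[OF resolvesD(6)[OF P, of 0]] resolvesD(2)[OF P] by (intro vec_rmul) simp
    then have "y a = rmul (rk P (Suc 0)) y1 (mt P 0) a" for a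
      using yv y1 resolvesD(2)[OF P] by (cases "a = 0") (simp_all add: vec_def 0)
    then have "y = rmul (rk P (Suc i)) y1 (mt P i)" by (intro ext) (simp add: 0)
    then show ?thesis using 1 by blast
  next
    case (Suc l)
    have "cat (rk X (Suc l)) (rmul (rk X (Suc i)) x (mt X i) + rmul (rk P i) y (f i))
        (- rmul (rk P i) y (mt P l)) = cat (rk X (Suc l)) 0 0"
      using w by (simp add: xy(2) Suc rmul_cone_Suc[OF Xc] cat_0)
    moreover have "vec (rk X (Suc l)) (rmul (rk X (Suc i)) x (mt X i) + rmul (rk P i) y (f i))"
      unfolding Suc by (intro vec_add vec_rmul graded_mapD(2)[OF resolvesD(6)[OF X]]
        graded_mapD(2)[OF chain_mapD(1)[OF f(1)]])
    ultimately have 1: "rmul (rk X (Suc i)) x (mt X i) + rmul (rk P i) y (f i) = 0"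
      and 2: "rmul (rk P i) y (mt P l) = 0"
      using cat_inject[of "rk X (Suc l)"] by (metis vec_0(1), metis vec_0(1) neg_equal_0_iff_equal)
    show ?thesis using 1 resolvesD(4)[OF P yv[unfolded Suc] 2[unfolded Suc]] Suc by simp
  qed
  then obtain y1 where y1: "y = rmul (rk P (Suc i)) y1 (mt P i)" by blast
  \<comment> \<open>Correcting \<open>x\<close> by the image of \<open>y1\<close> under
    \<open>f\<close> gives a cycle of \<open>X\<close>, the boundary of some \<open>x2\<close>. Then
    (x2, - y1) is mapped to (x, y), the minus sign undoing the one in the cone.\<close>
  have "rmul (rk X (Suc i)) (x + rmul (rk P (Suc i)) y1 (f (Suc i))) (mt X i) =
      rmul (rk X (Suc i)) x (mt X i) + rmul (rk P i) y (f i)"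
    by (simp only: y1 rmul_add_left rmul_assoc chain_mapD(2)[OF f(1)])
  also have "\<dots> = 0" using * by blast
  finally have "rmul (rk X (Suc i)) (x + rmul (rk P (Suc i)) y1 (f (Suc i))) (mt X i) = 0" .
  moreover have "vec (rk X (Suc i)) (x + rmul (rk P (Suc i)) y1 (f (Suc i)))"
    by (intro vec_add xy(1) vec_rmul graded_mapD(2)[OF chain_mapD(1)[OF f(1)]])
  ultimately obtain x2 where x2: "x + rmul (rk P (Suc i)) y1 (f (Suc i)) = rmul (rk X (Suc (Suc i))) x2 (mt X (Suc i))"
    using resolvesD(4)[OF X] by blast
  have "rmul (rk ?C (Suc (Suc i))) (cat (rk X (Suc (Suc i))) x2 (- y1)) (mt ?C (Suc i)) =
    cat (rk X (Suc i)) (rmul (rk X (Suc (Suc i))) x2 (mt X (Suc i)) - rmul (rk P (Suc i)) y1 (f (Suc i))) y"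
    by (simp add: rmul_cone_Suc[OF Xc] rmul_uminus_left y1)
  also have "\<dots> = w"
    by (simp only: x2[symmetric] xy(2) add_diff_cancel)
  finally show "\<exists>z. w = rmul (rk ?C (Suc (Suc i))) z (mt ?C (Suc i))" by metis
qed

section \<open>Homology of a cone after reduction\<close>

lemma cycle_0 [simp]: "cycle X i j 0"
  by (simp add: cycle_def)

lemma boundary_0 [simp]: "boundary X i j 0"
  unfolding boundary_def by (intro exI[of _ 0]) simp

text \<open>With \<open>f\<close> reduced to 0 the differential of the cone becomes block diagonal,
  so cycles and boundaries can be tested on the two blocks separately and no cancellation occurs
  between \<open>X\<close> and \<open>P\<close>.\<close>

lemma tor_support_cone:
  fixes P X :: "('v::finite, 'k::field) mpoly cx"
  assumes X: "graded_complex X" and f: "\<And>i. red (f i) = (\<lambda>_. 0)"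
  shows "tor_support (cone e f P X) = tor_support X \<union> {(Suc i, j + e) | i j. (i, j) \<in> tor_support P}"
proof -
  let ?C = "cone e f P X"
  have deg: "(\<forall>a. cat r x y a \<noteq> 0 \<longrightarrow> cat r d d' a = j) \<longleftrightarrow>
      (\<forall>a. x a \<noteq> 0 \<longrightarrow> d a = j) \<and> (\<forall>a. y a \<noteq> 0 \<longrightarrow> d' a = j)"
    if "vec r x" for x y :: "nat \<Rightarrow> 'k" and d d' :: "nat \<Rightarrow> int" and r j
  proof (intro iffI conjI allI impI)
    fix a assume *: "\<forall>a. cat r x y a \<noteq> 0 \<longrightarrow> cat r d d' a = j"
    show "d a = j" if "x a \<noteq> 0"
      using *[rule_format, of a] that \<open>vec r x\<close> by (cases "a < r") (auto simp: cat_def vec_def)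
    show "d' a = j" if "y a \<noteq> 0"
      using *[rule_format, of "r + a"] that by (simp add: cat_def)
  qed (auto simp: cat_def split: if_splits)
  have vX: "vec (rk X l) (rmul r x (red (mt X l)))" for l r x
    by (intro vec_rmul vec_red[OF graded_complexD(1)[OF X]])
  have cyc: "cycle ?C (Suc i) j (cat (rk X (Suc i)) x y) \<longleftrightarrow> cycle X (Suc i) j x \<and> cycle P i (j - e) y"
    if x: "vec (rk X (Suc i)) x" for i j x y
  proof -
    have "rmul (rk ?C (Suc i)) (cat (rk X (Suc i)) x y) (red (mt ?C i)) = 0 \<longleftrightarrow>
      rmul (rk X (Suc i)) x (red (mt X i)) = 0 \<and> (\<forall>l. i = Suc l \<longrightarrow> rmul (rk P i) y (red (mt P l)) = 0)"
    proof (cases i)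
      case 0
      then show ?thesis by (simp add: rmul_red_cone_0 f)
    next
      case (Suc l)
      have "cat (rk X (Suc l)) (rmul (rk X (Suc i)) x (red (mt X i))) (- rmul (rk P i) y (red (mt P l))) = 0
        \<longleftrightarrow> rmul (rk X (Suc i)) x (red (mt X i)) = 0 \<and> rmul (rk P i) y (red (mt P l)) = 0"
        using cat_inject[OF vX[of "Suc l"] vec_0(1)] unfolding Suc
        by (metis cat_0 neg_equal_0_iff_equal)
      then show ?thesis by (simp add: Suc rmul_red_cone_Suc[OF X] f)
    qed
    moreover have "(\<forall>a. y a \<noteq> 0 \<longrightarrow> dg P i a + e = j) \<longleftrightarrow> (\<forall>a. y a \<noteq> 0 \<longrightarrow> dg P i a = j - e)"
      by auto
    ultimately show ?thesis using x
      unfolding cycle_def cone_simps vec_cat_iff deg[OF x] by auto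
  qed
  have bnd: "boundary ?C (Suc i) j (cat (rk X (Suc i)) x y) \<longleftrightarrow> boundary X (Suc i) j x \<and> boundary P i (j - e) y"
    if x: "vec (rk X (Suc i)) x" for i j x y
  proof
    assume "boundary ?C (Suc i) j (cat (rk X (Suc i)) x y)"
    then obtain w where w: "\<And>a. w a \<noteq> 0 \<Longrightarrow> dg ?C (Suc (Suc i)) a = j"
      "cat (rk X (Suc i)) x y = rmul (rk ?C (Suc (Suc i))) w (red (mt ?C (Suc i)))"
      by (auto simp: boundary_def)
    obtain x' y' where x': "vec (rk X (Suc (Suc i))) x'" "w = cat (rk X (Suc (Suc i))) x' y'"
      using cat_cases by blast
    have "cat (rk X (Suc i)) x y = cat (rk X (Suc i)) (rmul (rk X (Suc (Suc i))) x' (red (mt X (Suc i))))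
        (rmul (rk P (Suc i)) (- y') (red (mt P i)))"
      using w(2) by (simp add: x'(2) rmul_red_cone_Suc[OF X] f rmul_uminus_left)
    note eq = cat_inject[OF x vX this]
    have "\<forall>a. w a \<noteq> 0 \<longrightarrow> dg ?C (Suc (Suc i)) a = j" using w(1) by blast
    then have d: "(\<forall>a. x' a \<noteq> 0 \<longrightarrow> dg X (Suc (Suc i)) a = j) \<and> (\<forall>a. y' a \<noteq> 0 \<longrightarrow> dg P (Suc i) a + e = j)"
      unfolding x'(2) cone_simps by (rule deg[OF x'(1), THEN iffD1])
    have "boundary P i (j - e) y"
      unfolding boundary_def using eq(2) d by (intro exI[of _ "- y'"]) auto
    moreover have "boundary X (Suc i) j x"
      unfolding boundary_def using eq(1) d by blast
    ultimately show "boundary X (Suc i) j x \<and> boundary P i (j - e) y" by blast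
  next
    assume "boundary X (Suc i) j x \<and> boundary P i (j - e) y"
    then obtain x' y' where x': "\<And>a. x' a \<noteq> 0 \<Longrightarrow> dg X (Suc (Suc i)) a = j" "x = rmul (rk X (Suc (Suc i))) x' (red (mt X (Suc i)))"
      and y': "\<And>a. y' a \<noteq> 0 \<Longrightarrow> dg P (Suc i) a = j - e" "y = rmul (rk P (Suc i)) y' (red (mt P i))"
      by (auto simp: boundary_def)
    let ?w = "cat (rk X (Suc (Suc i))) x' (- y')"
    have "cat (rk X (Suc i)) x y = rmul (rk ?C (Suc (Suc i))) ?w (red (mt ?C (Suc i)))"
      by (simp add: rmul_red_cone_Suc[OF X] f rmul_uminus_left x'(2) y'(2))
    moreover have "\<forall>a. ?w a \<noteq> 0 \<longrightarrow> dg ?C (Suc (Suc i)) a = j"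
      using x'(1) y'(1) by (auto simp: cone_simps cat_def)
    ultimately show "boundary ?C (Suc i) j (cat (rk X (Suc i)) x y)"
      unfolding boundary_def by blast
  qed
  \<comment> \<open>The cone has only X_0 in position 0, but its boundaries also come from P_0.
    These enter through \<open>f 0\<close> and vanish after reduction.\<close>
  have C0: "(0, j) \<in> tor_support ?C \<longleftrightarrow> (0, j) \<in> tor_support X" for j
  proof -
    have "boundary ?C 0 j c \<longleftrightarrow> boundary X 0 j c" for c
    proof
      assume "boundary ?C 0 j c"
      then obtain w where w: "\<And>a. w a \<noteq> 0 \<Longrightarrow> dg ?C (Suc 0) a = j"
        "c = rmul (rk ?C (Suc 0)) w (red (mt ?C 0))"
        by (auto simp: boundary_def)
      obtain x y where x: "vec (rk X (Suc 0)) x" "w = cat (rk X (Suc 0)) x y"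
        using cat_cases by blast
      have "c = rmul (rk X (Suc 0)) x (red (mt X 0))"
        using w(2) by (simp add: x(2) rmul_red_cone_0 f)
      moreover have "\<forall>a. w a \<noteq> 0 \<longrightarrow> dg ?C (Suc 0) a = j" using w(1) by blast
      then have "\<forall>a. x a \<noteq> 0 \<longrightarrow> dg X (Suc 0) a = j"
        unfolding x(2) cone_simps by (rule deg[OF x(1), THEN iffD1, THEN conjunct1])
      ultimately show "boundary X 0 j c" unfolding boundary_def by blast
    next
      assume "boundary X 0 j c"
      then obtain x where x: "\<And>a. x a \<noteq> 0 \<Longrightarrow> dg X (Suc 0) a = j" "c = rmul (rk X (Suc 0)) x (red (mt X 0))"
        by (auto simp: boundary_def)
      let ?w = "cat (rk X (Suc 0)) x 0"
      have "c = rmul (rk ?C (Suc 0)) ?w (red (mt ?C 0))"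
        by (simp add: rmul_red_cone_0 x(2))
      moreover have "\<forall>a. ?w a \<noteq> 0 \<longrightarrow> dg ?C (Suc 0) a = j"
        using x(1) by (auto simp: cone_simps cat_def)
      ultimately show "boundary ?C 0 j c" unfolding boundary_def by blast
    qed
    then show ?thesis by (simp add: tor_support_def cycle_def cone_simps)
  qed
  have CS: "(Suc i, j) \<in> tor_support ?C \<longleftrightarrow> (Suc i, j) \<in> tor_support X \<or> (i, j - e) \<in> tor_support P" for i j
  proof
    assume "(Suc i, j) \<in> tor_support ?C"
    then obtain c where c: "cycle ?C (Suc i) j c" "\<not> boundary ?C (Suc i) j c"
      by (auto simp: tor_support_def)
    obtain x y where x: "vec (rk X (Suc i)) x" "c = cat (rk X (Suc i)) x y"
      using cat_cases by blast
    show "(Suc i, j) \<in> tor_support X \<or> (i, j - e) \<in> tor_support P"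
      using c cyc[OF x(1)] bnd[OF x(1)] by (auto simp: x(2) tor_support_def)
  next
    assume "(Suc i, j) \<in> tor_support X \<or> (i, j - e) \<in> tor_support P"
    then show "(Suc i, j) \<in> tor_support ?C"
    proof
      assume "(Suc i, j) \<in> tor_support X"
      then obtain x where x: "cycle X (Suc i) j x" "\<not> boundary X (Suc i) j x"
        by (auto simp: tor_support_def)
      then have "vec (rk X (Suc i)) x" by (simp add: cycle_def)
      from cyc[OF this, of j 0] bnd[OF this, of j 0] x show ?thesis
        by (auto simp: tor_support_def)
    next
      assume "(i, j - e) \<in> tor_support P"
      then obtain y where "cycle P i (j - e) y" "\<not> boundary P i (j - e) y"
        by (auto simp: tor_support_def)
      with cyc[OF vec_0(1), of i j y] bnd[OF vec_0(1), of i j y] show ?thesis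
        by (auto simp: tor_support_def)
    qed
  qed
  show ?thesis
  proof (intro set_eqI)
    fix p :: "nat \<times> int"
    obtain i j where p: "p = (i, j)" by (cases p)
    show "p \<in> tor_support ?C \<longleftrightarrow> p \<in> tor_support X \<union> {(Suc i, j + e) | i j. (i, j) \<in> tor_support P}"
    proof (cases i)
      case 0
      then show ?thesis by (simp add: p C0)
    next
      case (Suc l)
      have "(\<exists>j'. j = j' + e \<and> (l, j') \<in> tor_support P) \<longleftrightarrow> (l, j - e) \<in> tor_support P"
        by (metis add_diff_cancel diff_add_cancel)
      then show ?thesis by (simp add: p Suc CS)
    qed
  qed
qed

lemma rmul_scale_left: "rmul r (\<lambda>a. w * x a) A = (\<lambda>b. w * rmul r x A b)"
  unfolding rmul_def sum_distrib_left by (simp only: mult.assoc)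

lemma rmul_scale_right: "rmul r x (\<lambda>a b. w * A a b) = (\<lambda>b. w * rmul r x A b)"
  unfolding rmul_def sum_distrib_left by (simp only: mult.left_commute)

text \<open>The hypothesis \<open>L z \<subseteq> M\<close> makes the comparison map a multiple of \<open>w\<close>, so it vanishes modulo
  the variables and the mapping cone behaves like a direct sum.\<close>

lemma tor_support_adjoin:
  fixes P X :: "('v::finite, 'k::field) mpoly cx"
  assumes P: "resolves P L" and X: "resolves X M"
    and w: "homogeneous w d" "const_term w = 0" and z: "homogeneous z e"
    and L: "\<And>p. p \<in> L \<longleftrightarrow> p * (w * z) \<in> M" and Lz: "\<And>p. p \<in> L \<Longrightarrow> p * z \<in> M"
  shows "\<exists>C. resolves C {b + c * (w * z) | b c. b \<in> M} \<and>
    tor_support C = tor_support X \<union> {(Suc i, j + (d + e)) | i j. (i, j) \<in> tor_support P}"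
proof -
  obtain g where g: "chain_map e P X g" "g 0 = scalar_mat z"
    using mult_chain_map_exists[OF P X z Lz] by blast
  define f where "f = (\<lambda>i a b. w * g i a b)"
  note gD = graded_mapD[OF chain_mapD(1)[OF g(1)]]
  have "graded_map (d + e) P i X i (f i)" for i
    unfolding graded_map_def
  proof (intro conjI allI impI)
    fix a b
    show "homogeneous (f i a b) (dg P i a + (d + e) - dg X i b)"
      using homogeneous_mult[OF w(1) gD(3)[of i a b]] by (simp add: f_def algebra_simps)
  next
    fix a assume "rk P i \<le> a"
    then show "f i a = 0" using gD(1)[of i a] by (simp add: f_def fun_eq_iff)
  next
    fix a show "vec (rk X i) (f i a)" using gD(2)[of i a] by (simp add: f_def vec_def)
  qed
  then have f: "chain_map (d + e) P X f"
    unfolding chain_map_def by (simp add: f_def rmul_scale_left rmul_scale_right chain_mapD(2)[OF g(1)])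
  have "red (f i) = (\<lambda>_. 0)" for i
    by (rule ext)+ (simp add: red_def f_def const_term_mult w(2))
  then have "tor_support (cone (d + e) f P X) =
      tor_support X \<union> {(Suc i, j + (d + e)) | i j. (i, j) \<in> tor_support P}"
    using tor_support_cone[OF resolvesD(1)[OF X]] by blast
  moreover have "f 0 0 0 = w * z" by (simp add: f_def g(2) scalar_mat_def)
  ultimately show ?thesis using resolves_cone[OF P X f _ iffD2[OF L]] by blast
qed

section \<open>Resolutions of monomial ideals\<close>

definition zero_complex :: "('v, 'k::field) mpoly cx" where
  "zero_complex = \<lparr>rk = (\<lambda>i. if i = 0 then 1 else 0), dg = (\<lambda>_ _. 0), mt = (\<lambda>_ _ _. 0)\<rparr>"

lemma resolves_zero_complex: "resolves zero_complex {0}"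
  by (auto simp: resolves_def zero_complex_def graded_complex_def graded_map_def rmul_def vec_def fun_eq_iff)

text \<open>Iterated mapping cones. Splitting off a generator \<open>t\<close> leaves
  \<open>T'\<close> and a colon ideal with at most as many generators as \<open>T'\<close>, hence an
  induction on a bound for the cardinality that applies to both. The bounded length is kept for the
  finiteness of the support.\<close>

lemma monomial_resolution_exists:
  "finite T \<Longrightarrow> card T \<le> n \<Longrightarrow>
    \<exists>(X :: ('v::finite, 'k::field) mpoly cx) N. resolves X (ideal_gen (monom ` T)) \<and> (\<forall>i\<ge>N. rk X i = 0)"
proof (induction n arbitrary: T)
  have "\<exists>(X :: ('v::finite, 'k::field) mpoly cx) N. resolves X {0} \<and> (\<forall>i\<ge>N. rk X i = 0)"
    by (intro exI[of _ zero_complex] exI[of _ 1] conjI resolves_zero_complex) (simp add: zero_complex_def)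
  then have empty: "\<exists>(X :: ('v, 'k) mpoly cx) N. resolves X (ideal_gen (monom ` {})) \<and> (\<forall>i\<ge>N. rk X i = 0)"
    by (simp add: ideal_gen_def)
  { case 0 then show ?case using empty by simp }
  case (Suc n)
  show ?case
  proof (cases "T = {}")
    case False
    then obtain t T' where T: "T = insert t T'" "t \<notin> T'" by (meson Set.set_insert ex_in_conv)
    let ?L = "(\<lambda>s. s - t) ` T'"
    have T': "finite T'" "card T' \<le> n" using Suc.prems T by auto
    moreover have "finite ?L" "card ?L \<le> n"
      using T' card_image_le[of T' "\<lambda>s. s - t"] by auto
    ultimately obtain X P :: "('v, 'k) mpoly cx" and N N'
      where X: "resolves X (ideal_gen (monom ` T'))" "\<forall>i\<ge>N. rk X i = 0"
        and P: "resolves P (ideal_gen (monom ` ?L))" "\<forall>i\<ge>N'. rk P i = 0"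
      using Suc.IH[of T'] Suc.IH[of ?L] by blast
    obtain f where f: "chain_map (int (mono_deg t)) P X f" "f 0 = scalar_mat (monom t)"
      using mult_chain_map_exists[OF P(1) X(1) homogeneous_monom] monomial_colon by blast
    let ?C = "cone (int (mono_deg t)) f P X"
    have "resolves ?C {b + c * monom t | b c. b \<in> ideal_gen (monom ` T')}"
      by (rule resolves_cone[OF P(1) X(1) f(1)]) (auto simp: f(2) scalar_mat_def monomial_colon)
    then have "resolves ?C (ideal_gen (monom ` T))"
      by (simp add: T ideal_gen_insert)
    moreover have "\<forall>i\<ge>Suc (max N N'). rk ?C i = 0"
    proof (intro allI impI)
      fix i assume "Suc (max N N') \<le> i"
      then obtain l where "i = Suc l" "max N N' \<le> l" by (metis Suc_le_D Suc_le_mono)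
      then show "rk ?C i = 0" using X(2) P(2) by (simp add: cone_simps)
    qed
    ultimately show ?thesis by blast
  qed (use empty in simp)
qed

text \<open>All members of the union coincide by \<open>tor_support_unique\<close>, so this depends
  on the ideal alone and no resolution has to be chosen.\<close>

definition tor_quot :: "('v, 'k::field) mpoly set \<Rightarrow> (nat \<times> int) set" where
  "tor_quot I = \<Union>{tor_support X | X. resolves X I}"

lemma tor_quot_eq:
  fixes X :: "('v::finite, 'k::field) mpoly cx"
  assumes "resolves X I"
  shows "tor_quot I = tor_support X"
  using assms tor_support_unique[OF _ assms] unfolding tor_quot_def by blast

section \<open>Finiteness of the support and its positions 0 and 1\<close>

lemma finite_tor_support:
  assumes "\<forall>i\<ge>N. rk X i = 0"
  shows "finite (tor_support X)"
proof (rule finite_subset)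
  show "tor_support X \<subseteq> (\<Union>i<N. {i} \<times> dg X i ` {..<rk X i})"
  proof
    fix p assume "p \<in> tor_support X"
    then obtain i j c where c: "p = (i, j)" "cycle X i j c" "\<not> boundary X i j c"
      by (auto simp: tor_support_def)
    then have "c \<noteq> 0" by auto
    then obtain a where "c a \<noteq> 0" by (auto simp: fun_eq_iff)
    then have a: "a < rk X i" "dg X i a = j" using c(2) by (auto simp: cycle_def vec_def not_le[symmetric])
    moreover have "i < N" using a(1) assms by (metis not_le less_zeroE)
    ultimately show "p \<in> (\<Union>i<N. {i} \<times> dg X i ` {..<rk X i})" using c(1) by auto
  qed
qed simp

lemma red_augmentation:
  assumes X: "resolves X I" and I: "\<And>p. p \<in> I \<Longrightarrow> const_term p = 0"
  shows "red (mt X 0) = (\<lambda>_. 0)"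
proof (rule ext)+
  fix a b
  show "red (mt X 0) a b = 0 b"
  proof (cases "b = 0")
    case True
    then show ?thesis using I[OF resolves_row_in_ideal[OF X]] by (simp add: red_def)
  next
    case False
    then show ?thesis
      using graded_mapD(2)[OF resolvesD(6)[OF X, of 0], of a] resolvesD(2)[OF X]
      by (simp add: red_def vec_def)
  qed
qed

text \<open>As \<open>I\<close> lies in the ideal of the variables, the augmentation reduces to 0,
  so the class of 1 survives in Tor_0(R / I, k), which is k in degree 0.\<close>

lemma tor_support_0:
  assumes X: "resolves X I" and I: "\<And>p. p \<in> I \<Longrightarrow> const_term p = 0"
  shows "(0, j) \<in> tor_support X \<longleftrightarrow> j = 0"
proof
  assume "(0, j) \<in> tor_support X"
  then obtain c where c: "cycle X 0 j c" "\<not> boundary X 0 j c" by (auto simp: tor_support_def)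
  then have "c \<noteq> 0" by auto
  then obtain a where "c a \<noteq> 0" by (auto simp: fun_eq_iff)
  then show "j = 0" using c(1) resolvesD(2,3)[OF X] by (cases a) (auto simp: cycle_def vec_def)
next
  assume "j = 0"
  have "unit_vec 1 0 \<noteq> (0 :: nat \<Rightarrow> 'b)" by (auto simp: unit_vec_def fun_eq_iff)
  moreover have "cycle X 0 j (unit_vec 1 0)"
    using resolvesD(2,3)[OF X] \<open>j = 0\<close> by (auto simp: cycle_def vec_def unit_vec_def)
  ultimately show "(0, j) \<in> tor_support X"
    by (auto simp: tor_support_def boundary_def red_augmentation[OF X I])
qed

lemma homogeneous_nonpos:
  fixes p :: "('v::finite, 'k::field) mpoly"
  assumes "homogeneous p d" "d \<le> 0"
  shows "p = Poly_Mapping.single 0 (const_term p)"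
proof (rule poly_mapping_eqI)
  fix t
  show "Poly_Mapping.lookup p t = Poly_Mapping.lookup (Poly_Mapping.single 0 (const_term p)) t"
  proof (cases "t = 0")
    case False
    then have "mono_deg t > 0" using mono_deg_eq_0 by blast
    then have "t \<notin> Poly_Mapping.keys p" using assms by (auto simp: homogeneous_def)
    then show ?thesis using False by (simp add: in_keys_iff lookup_single when_def)
  qed simp
qed

text \<open>A generator of least degree in a resolution survives the reduction.\<close>

lemma tor_support_1:
  fixes X :: "('v::finite, 'k::field) mpoly cx"
  assumes X: "resolves X I" and I: "\<And>p. p \<in> I \<Longrightarrow> const_term p = 0" "I \<noteq> {0}"
  shows "\<exists>d\<ge>1. (1, d) \<in> tor_support X"
proof -
  note XD = graded_mapD[OF resolvesD(6)[OF X, of 0]]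
  define A where "A = {a. a < rk X (Suc 0) \<and> mt X 0 a 0 \<noteq> 0}"
  have "A \<noteq> {}"
  proof
    assume "A = {}"
    then have "rmul (rk X (Suc 0)) y (mt X 0) 0 = 0" for y
      unfolding rmul_def A_def by (intro sum.neutral) auto
    then have "I = {0}" using resolvesD(5)[OF X] by auto
    then show False using I(2) by simp
  qed
  moreover have "finite A" by (simp add: A_def)
  ultimately obtain a where a: "a \<in> A" "\<And>b. b \<in> A \<Longrightarrow> dg X (Suc 0) a \<le> dg X (Suc 0) b"
    using arg_min_if_finite(1)[of A "dg X (Suc 0)"] arg_min_least[of A _ "dg X (Suc 0)"] by metis
  define d where "d = dg X (Suc 0) a"
  have a': "a < rk X (Suc 0)" "mt X 0 a 0 \<noteq> 0" using a(1) by (auto simp: A_def)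
  \<comment> \<open>A homogeneous polynomial of degree at most 0 is a constant, and \<open>I\<close>
    contains no nonzero constant.\<close>
  have "d \<ge> 1"
  proof (rule ccontr)
    assume "\<not> 1 \<le> d"
    then have "mt X 0 a 0 = Poly_Mapping.single 0 (const_term (mt X 0 a 0))"
      using XD(3)[of a 0] resolvesD(3)[OF X] by (intro homogeneous_nonpos[of _ d]) (auto simp: d_def)
    then show False using I(1)[OF resolves_row_in_ideal[OF X]] a'(2) by (metis single_zero)
  qed
  moreover have "cycle X 1 d (unit_vec (rk X (Suc 0)) a)"
    by (auto simp: cycle_def red_augmentation[OF X I(1)] d_def) (simp add: unit_vec_def split: if_splits)
  moreover have "\<not> boundary X 1 d (unit_vec (rk X (Suc 0)) a)"
  proof
    assume "boundary X 1 d (unit_vec (rk X (Suc 0)) a)"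
    then obtain e where e: "\<And>b. e b \<noteq> 0 \<Longrightarrow> dg X (Suc 1) b = d"
      "unit_vec (rk X (Suc 0)) a = rmul (rk X (Suc 1)) e (red (mt X 1))"
      by (auto simp: boundary_def)
    \<comment> \<open>Lifts the chain that bounds the reduced basis vector to constants of R. Since
      \<open>d\<close> is least on \<open>A\<close>, the entries of \<open>y\<close> at
      \<open>A\<close> have degree at most 0 and are thus constants, namely those of the unit
      vector; off \<open>A\<close> the generators are 0. So \<open>y\<close> maps to the a-th
      generator, although as a boundary it maps to 0.\<close>
    define y where "y = rmul (rk X (Suc 1)) (\<lambda>b. Poly_Mapping.single 0 (e b)) (mt X 1)"
    have hom: "homogeneous (y b) (d - dg X (Suc 0) b)" for b
      unfolding y_def rmul_def
    proof (rule homogeneous_sum)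
      fix c
      show "homogeneous (Poly_Mapping.single 0 (e c) * mt X 1 c b) (d - dg X (Suc 0) b)"
      proof (cases "e c = 0")
        case False
        have "homogeneous (Poly_Mapping.single 0 (e c) :: ('v, 'k) mpoly) 0"
          by (auto simp: homogeneous_def)
        from homogeneous_mult[OF this graded_mapD(3)[OF resolvesD(6)[OF X, of 1], of c b]]
        show ?thesis using e(1)[OF False] by simp
      qed simp
    qed
    have const: "const_term (y b) = unit_vec (rk X (Suc 0)) a b" for b
      by (simp add: y_def e(2) rmul_def lookup_sum const_term_mult red_def)
    have "y b * mt X 0 b 0 = (if b = a then mt X 0 a 0 else 0)" if "b < rk X (Suc 0)" for b
    proof (cases "b \<in> A")
      case True
      then have "y b = Poly_Mapping.single 0 (const_term (y b))"
        using homogeneous_nonpos[OF hom] a(2) by (simp add: d_def)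
      then have "y b = Poly_Mapping.single 0 (unit_vec (rk X (Suc 0)) a b)"
        by (simp only: const)
      then show ?thesis using a'(1) by (auto simp: unit_vec_def)
    qed (use that a(1) in \<open>auto simp: A_def\<close>)
    then have "rmul (rk X (Suc 0)) y (mt X 0) 0 = mt X 0 a 0"
      using a'(1) by (simp add: rmul_def)
    moreover have "rmul (rk X (Suc 0)) y (mt X 0) = 0"
      unfolding y_def using resolvesD(7)[OF X, of 0] by (simp add: rmul_assoc)
    ultimately show False using a'(2) by simp
  qed
  ultimately show ?thesis by (auto simp: tor_support_def)
qed

section \<open>Betti numbers\<close>

lemma lookup_smult: "Poly_Mapping.lookup (smult c f) b = c * Poly_Mapping.lookup f b"
  by (simp add: smult_def map.rep_eq when_def)

lemma lookup_lin_map: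
  assumes "Poly_Mapping.keys f \<subseteq> {..<r}"
  shows "Poly_Mapping.lookup (lin_map d f) = rmul r (Poly_Mapping.lookup f) (\<lambda>a. Poly_Mapping.lookup (d a))"
proof
  fix b
  show "Poly_Mapping.lookup (lin_map d f) b = rmul r (Poly_Mapping.lookup f) (\<lambda>a. Poly_Mapping.lookup (d a)) b"
    unfolding lin_map_def lookup_sum lookup_smult rmul_def
    using assms by (intro sum.mono_neutral_left) (auto simp: in_keys_iff)
qed

lemma aug_map_eq:
  assumes "Poly_Mapping.keys f \<subseteq> {..<r}"
  shows "aug_map F f = (\<Sum>a<r. Poly_Mapping.lookup f a * aug F a)"
  unfolding aug_map_def using assms by (intro sum.mono_neutral_left) (auto simp: in_keys_iff)

definition pm_of :: "nat \<Rightarrow> (nat \<Rightarrow> 'a::zero) \<Rightarrow> (nat \<Rightarrow>\<^sub>0 'a)" where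
  "pm_of r x = Abs_poly_mapping (\<lambda>a. if a < r then x a else 0)"

lemma lookup_pm_of: "Poly_Mapping.lookup (pm_of r x) a = (if a < r then x a else 0)"
proof -
  have "finite {a. (if a < r then x a else 0) \<noteq> 0}"
    by (rule finite_subset[of _ "{..<r}"]) auto
  then show ?thesis by (simp add: pm_of_def)
qed

lemma keys_pm_of: "Poly_Mapping.keys (pm_of r x) \<subseteq> {..<r}"
  by (auto simp: in_keys_iff lookup_pm_of split: if_splits)

lemma pm_of_lookup: "Poly_Mapping.keys f \<subseteq> {..<r} \<Longrightarrow> pm_of r (Poly_Mapping.lookup f) = f"
  by (rule poly_mapping_eqI) (auto simp: lookup_pm_of in_keys_iff)

lemma rmul_pm_of: "rmul r (Poly_Mapping.lookup (pm_of r x)) A = rmul r x A"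
  unfolding rmul_def by (simp add: lookup_pm_of)

lemma vec_lookup_iff: "vec r (Poly_Mapping.lookup f) \<longleftrightarrow> Poly_Mapping.keys f \<subseteq> {..<r}"
  by (auto simp: vec_def in_keys_iff not_le[symmetric] subset_iff)

text \<open>Puts R in front of a resolution of I. \<open>graded_free_resolution\<close> leaves the
  data beyond the ranks arbitrary, so these rows are replaced by 0, as \<open>graded_map\<close>
  demands.\<close>

definition quot_cx :: "('v, 'k::field) free_complex \<Rightarrow> ('v, 'k) mpoly cx" where
  "quot_cx F =
    \<lparr>rk = (\<lambda>i. case i of 0 \<Rightarrow> 1 | Suc l \<Rightarrow> frank F l),
     dg = (\<lambda>i. case i of 0 \<Rightarrow> (\<lambda>_. 0) | Suc l \<Rightarrow> fdeg F l),
     mt = (\<lambda>i. case i of 0 \<Rightarrow> (\<lambda>a b. if a < frank F 0 \<and> b = 0 then aug F a else 0)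
       | Suc l \<Rightarrow> (\<lambda>a. if a < frank F (Suc l) then Poly_Mapping.lookup (diff F l a) else 0))\<rparr>"

lemma quot_cx_simps:
  "rk (quot_cx F) 0 = 1" "rk (quot_cx F) (Suc l) = frank F l"
  "dg (quot_cx F) 0 = (\<lambda>_. 0)" "dg (quot_cx F) (Suc l) = fdeg F l"
  "mt (quot_cx F) 0 = (\<lambda>a b. if a < frank F 0 \<and> b = 0 then aug F a else 0)"
  "mt (quot_cx F) (Suc l) = (\<lambda>a. if a < frank F (Suc l) then Poly_Mapping.lookup (diff F l a) else 0)"
  by (simp_all add: quot_cx_def)

lemma rmul_quot_cx_0:
  "rmul (frank F 0) x (mt (quot_cx F) 0) = (\<lambda>b. if b = 0 then \<Sum>a<frank F 0. x a * aug F a else 0)"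
  by (rule ext) (simp add: rmul_def quot_cx_simps)

lemma rmul_quot_cx_Suc:
  assumes "f \<in> free_mod (frank F (Suc l))"
  shows "rmul (frank F (Suc l)) (Poly_Mapping.lookup f) (mt (quot_cx F) (Suc l)) =
    Poly_Mapping.lookup (lin_map (diff F l) f)"
  using assms lookup_lin_map[of f "frank F (Suc l)" "diff F l"]
  by (auto simp: free_mod_def quot_cx_simps intro: rmul_cong)

lemma free_mod_iff: "f \<in> free_mod r \<longleftrightarrow> vec r (Poly_Mapping.lookup f)"
  by (simp add: free_mod_def vec_lookup_iff)

lemma pm_of_in_free_mod: "pm_of r x \<in> free_mod r"
  by (simp add: free_mod_def keys_pm_of)

lemma aug_map_free_mod:
  "f \<in> free_mod (frank F 0) \<Longrightarrow>
     aug_map F f = (\<Sum>a<frank F 0. Poly_Mapping.lookup f a * aug F a)"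
  by (simp add: free_mod_def aug_map_eq)

lemma lookup_pm_of_vec: "vec r x \<Longrightarrow> Poly_Mapping.lookup (pm_of r x) = x"
  by (rule ext) (simp add: lookup_pm_of vec_def)

lemma resolves_quot_cx:
  assumes "graded_free_resolution I F"
  shows "resolves (quot_cx F) I"
proof -
  let ?X = "quot_cx F"
  have aug: "\<And>a. a < frank F 0 \<Longrightarrow> homogeneous (aug F a) (fdeg F 0 a)"
    and diff: "\<And>i a. a < frank F (Suc i) \<Longrightarrow> diff F i a \<in> free_mod (frank F i)"
      "\<And>i a b. a < frank F (Suc i) \<Longrightarrow> b < frank F i \<Longrightarrow>
         homogeneous (Poly_Mapping.lookup (diff F i a) b) (fdeg F (Suc i) a - fdeg F i b)"
    and img: "aug_map F ` free_mod (frank F 0) = I"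
    and ex0: "{f \<in> free_mod (frank F 0). aug_map F f = 0} = lin_map (diff F 0) ` free_mod (frank F 1)"
    and ex: "\<And>i. {f \<in> free_mod (frank F (Suc i)). lin_map (diff F i) f = 0} =
        lin_map (diff F (Suc i)) ` free_mod (frank F (Suc (Suc i)))"
    using assms unfolding graded_free_resolution_def by auto
  have gm: "graded_map 0 ?X (Suc i) ?X i (mt ?X i)" for i
  proof (cases i)
    case 0
    then show ?thesis using aug
      by (auto simp: graded_map_def quot_cx_simps vec_def fun_eq_iff)
  next
    case (Suc l)
    have "homogeneous (Poly_Mapping.lookup (diff F l a) b) (fdeg F (Suc l) a - fdeg F l b)"
      if "a < frank F (Suc l)" for a b
      using diff[OF that] by (cases "b < frank F l") (auto simp: free_mod_iff vec_def)
    then show ?thesis using diff(1)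
      by (auto simp: graded_map_def quot_cx_simps Suc free_mod_iff)
  qed
  have exact: "rmul (rk ?X (Suc i)) (Poly_Mapping.lookup f) (mt ?X i) = 0 \<longleftrightarrow>
      f \<in> lin_map (diff F i) ` free_mod (frank F (Suc i))"
    if f: "f \<in> free_mod (frank F i)" for i f
  proof (cases i)
    case 0
    have "rmul (rk ?X (Suc i)) (Poly_Mapping.lookup f) (mt ?X i) = 0 \<longleftrightarrow> aug_map F f = 0"
      using aug_map_free_mod[of f F] f by (auto simp: 0 quot_cx_simps(2) rmul_quot_cx_0 fun_eq_iff)
    then show ?thesis using ex0 f by (auto simp: 0)
  next
    case (Suc l)
    have "rmul (rk ?X (Suc i)) (Poly_Mapping.lookup f) (mt ?X i) = 0 \<longleftrightarrow> lin_map (diff F l) f = 0"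
      using f by (simp add: Suc quot_cx_simps(2) rmul_quot_cx_Suc) (simp add: poly_mapping_eq_iff fun_eq_iff)
    then show ?thesis using ex[of l] f by (auto simp: Suc)
  qed
  show ?thesis
    unfolding resolves_def graded_complex_def
  proof (intro conjI allI impI gm)
    show "rk ?X 0 = 1" "dg ?X 0 0 = 0" by (simp_all add: quot_cx_simps)
    fix i
    show "rmul (rk ?X (Suc i)) (mt ?X (Suc i) a) (mt ?X i) = 0" for a
    proof (cases "a < frank F (Suc i)")
      case True
      have "smult 1 f = f" for f :: "nat \<Rightarrow>\<^sub>0 ('a, 'b) mpoly"
        by (rule poly_mapping_eqI) (simp add: lookup_smult)
      then have "lin_map (diff F i) (Poly_Mapping.single a 1) = diff F i a"
        by (simp add: lin_map_def)
      moreover have "Poly_Mapping.single a 1 \<in> free_mod (frank F (Suc i))"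
        using True by (simp add: free_mod_def)
      ultimately have "diff F i a \<in> lin_map (diff F i) ` free_mod (frank F (Suc i))" by (metis imageI)
      then show ?thesis using exact[OF diff(1)[OF True]] True by (simp add: quot_cx_simps(6))
    qed (simp add: quot_cx_simps(6))
    fix x assume x: "vec (rk ?X (Suc i)) x \<and> rmul (rk ?X (Suc i)) x (mt ?X i) = 0"
    define f where "f = pm_of (frank F i) x"
    have f: "f \<in> free_mod (frank F i)" "Poly_Mapping.lookup f = x"
      using x by (simp_all add: f_def pm_of_in_free_mod lookup_pm_of_vec quot_cx_simps)
    then obtain g where g: "g \<in> free_mod (frank F (Suc i))" "f = lin_map (diff F i) g"
      using exact[OF f(1)] x by auto
    then have "x = rmul (rk ?X (Suc (Suc i))) (Poly_Mapping.lookup g) (mt ?X (Suc i))"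
      using f(2) by (simp add: quot_cx_simps(2) rmul_quot_cx_Suc)
    then show "\<exists>y. x = rmul (rk ?X (Suc (Suc i))) y (mt ?X (Suc i))" by blast
  next
    show "{rmul (rk ?X 1) y (mt ?X 0) 0 | y. True} = I"
    proof -
      have "rmul (rk ?X 1) y (mt ?X 0) 0 = aug_map F (pm_of (frank F 0) y)" for y
        by (simp add: quot_cx_simps(2) rmul_quot_cx_0 aug_map_free_mod pm_of_in_free_mod lookup_pm_of)
      moreover have "\<exists>y. f = pm_of (frank F 0) y" if "f \<in> free_mod (frank F 0)" for f :: "nat \<Rightarrow>\<^sub>0 ('a, 'b) mpoly"
        using pm_of_lookup that unfolding free_mod_def by (metis mem_Collect_eq)
      ultimately show ?thesis unfolding img[symmetric] using pm_of_in_free_mod by fastforce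
    qed
  qed
qed

text \<open>Ensures that the \<open>SOME\<close> in \<open>betti\<close> really picks a
  resolution.\<close>

lemma graded_free_resolution_exists:
  assumes X: "resolves X I"
  shows "\<exists>F. graded_free_resolution I F"
proof -
  define F where "F = \<lparr>frank = (\<lambda>i. rk X (Suc i)), fdeg = (\<lambda>i. dg X (Suc i)), aug = (\<lambda>a. mt X 0 a 0),
    diff = (\<lambda>i a. pm_of (rk X (Suc i)) (mt X (Suc i) a))\<rparr>"
  have F: "frank F i = rk X (Suc i)" "fdeg F i = dg X (Suc i)" "aug F a = mt X 0 a 0"
    "diff F i a = pm_of (rk X (Suc i)) (mt X (Suc i) a)" for i a
    by (simp_all add: F_def)
  note XD = graded_mapD[OF resolvesD(6)[OF X]]
  have lin: "Poly_Mapping.lookup (lin_map (diff F i) f) = rmul (rk X (Suc (Suc i))) (Poly_Mapping.lookup f) (mt X (Suc i))"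
    if "f \<in> free_mod (frank F (Suc i))" for i f
    using that by (simp add: free_mod_def F lookup_lin_map lookup_pm_of_vec XD(2))
  have augm: "aug_map F f = rmul (rk X (Suc 0)) (Poly_Mapping.lookup f) (mt X 0) 0"
    if "f \<in> free_mod (frank F 0)" for f
    using aug_map_free_mod[OF that] by (simp add: rmul_def F)
  have augm0: "aug_map F f = 0 \<longleftrightarrow> rmul (rk X (Suc 0)) (Poly_Mapping.lookup f) (mt X 0) = 0"
    if "f \<in> free_mod (frank F 0)" for f
  proof -
    have "vec 1 (rmul (rk X (Suc 0)) (Poly_Mapping.lookup f) (mt X 0))"
      using XD(2)[of 0] resolvesD(2)[OF X] by (intro vec_rmul) simp
    then have "rmul (rk X (Suc 0)) (Poly_Mapping.lookup f) (mt X 0) a = 0" if "a \<noteq> 0" for a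
      using that by (simp add: vec_def)
    then show ?thesis unfolding augm[OF that] fun_eq_iff zero_fun_apply by metis
  qed
  have lin0: "lin_map (diff F i) f = 0 \<longleftrightarrow> rmul (rk X (Suc (Suc i))) (Poly_Mapping.lookup f) (mt X (Suc i)) = 0"
    if "f \<in> free_mod (frank F (Suc i))" for i f
    unfolding lin[OF that, symmetric] by (simp add: poly_mapping_eq_iff fun_eq_iff)
  have exact: "rmul (rk X (Suc i)) (Poly_Mapping.lookup f) (mt X i) = 0 \<longleftrightarrow>
      f \<in> lin_map (diff F i) ` free_mod (frank F (Suc i))"
    if f: "f \<in> free_mod (frank F i)" for i f
  proof
    assume "rmul (rk X (Suc i)) (Poly_Mapping.lookup f) (mt X i) = 0"
    then obtain y where y: "Poly_Mapping.lookup f = rmul (rk X (Suc (Suc i))) y (mt X (Suc i))"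
      using resolvesD(4)[OF X] f by (auto simp: free_mod_iff F)
    have "Poly_Mapping.lookup f = Poly_Mapping.lookup (lin_map (diff F i) (pm_of (rk X (Suc (Suc i))) y))"
      by (simp add: lin pm_of_in_free_mod F(1) y rmul_pm_of)
    then have "f = lin_map (diff F i) (pm_of (rk X (Suc (Suc i))) y)"
      by (rule iffD1[OF poly_mapping.lookup_inject])
    then show "f \<in> lin_map (diff F i) ` free_mod (frank F (Suc i))" by (auto simp: F pm_of_in_free_mod)
  next
    assume "f \<in> lin_map (diff F i) ` free_mod (frank F (Suc i))"
    then obtain g where "g \<in> free_mod (frank F (Suc i))" "f = lin_map (diff F i) g" by blast
    then have "Poly_Mapping.lookup f = rmul (rk X (Suc (Suc i))) (Poly_Mapping.lookup g) (mt X (Suc i))"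
      by (simp add: lin)
    then show "rmul (rk X (Suc i)) (Poly_Mapping.lookup f) (mt X i) = 0"
      by (simp only: rmul_assoc resolvesD(7)[OF X]) simp
  qed
  have in_free: "lin_map (diff F i) f \<in> free_mod (frank F i)" if "f \<in> free_mod (frank F (Suc i))" for i f
    unfolding free_mod_iff lin[OF that] F by (intro vec_rmul XD(2))
  have "graded_free_resolution I F"
    unfolding graded_free_resolution_def
  proof (intro conjI allI impI)
    show "homogeneous (aug F a) (fdeg F 0 a)" for a
      using XD(3)[of 0 a 0] by (simp add: F resolvesD(3)[OF X])
    show "diff F i a \<in> free_mod (frank F i)" for i a by (simp add: F pm_of_in_free_mod)
    show "homogeneous (Poly_Mapping.lookup (diff F i a) b) (fdeg F (Suc i) a - fdeg F i b)" for i a b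
      using XD(3)[of "Suc i" a b] by (simp add: F lookup_pm_of)
    show "aug_map F ` free_mod (frank F 0) = I"
    proof (intro equalityI subsetI)
      fix p assume "p \<in> I"
      then obtain y where "p = rmul (rk X (Suc 0)) y (mt X 0) 0" using resolvesD(5)[OF X] by blast
      then have "p = aug_map F (pm_of (rk X (Suc 0)) y)"
        by (simp add: augm pm_of_in_free_mod F(1) rmul_pm_of)
      then show "p \<in> aug_map F ` free_mod (frank F 0)" by (auto simp: F pm_of_in_free_mod)
    next
      fix p assume "p \<in> aug_map F ` free_mod (frank F 0)"
      then show "p \<in> I" using augm resolvesD(5)[OF X] by auto
    qed
    show "{f \<in> free_mod (frank F 0). aug_map F f = 0} = lin_map (diff F 0) ` free_mod (frank F 1)"
      using exact[of _ 0] augm0 in_free[of _ 0] by auto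
    show "{f \<in> free_mod (frank F (Suc i)). lin_map (diff F i) f = 0} =
        lin_map (diff F (Suc i)) ` free_mod (frank F (Suc (Suc i)))" for i
      using exact[of _ "Suc i"] lin0 in_free[of _ "Suc i"] by auto
  qed
  then show ?thesis ..
qed

text \<open>A basis of \<open>B\<close> together with a vector of \<open>Z\<close> outside
  \<open>B\<close> extends to a basis of \<open>Z\<close>. The spanning set \<open>W\<close> makes
  that basis finite, so the strict inclusion shows in the cardinalities.\<close>

lemma (in vector_space) dim_diff_neq_0_iff:
  assumes B: "subspace B" "B \<subseteq> Z" and Z: "Z \<subseteq> span W" "finite W"
  shows "dim Z - dim B \<noteq> 0 \<longleftrightarrow> B \<noteq> Z"
proof
  assume "B \<noteq> Z"
  then obtain z where z: "z \<in> Z" "z \<notin> B" using B by blast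
  obtain b where b: "b \<subseteq> B" "independent b" "B \<subseteq> span b" "card b = dim B" using basis_exists by blast
  have "span b \<subseteq> B" using span_minimal[OF b(1) B(1)] .
  then have ind: "independent (insert z b)" and zb: "z \<notin> b"
    using z b(1) independent_insertI[OF _ b(2), of z] by blast+
  obtain c where c: "insert z b \<subseteq> c" "c \<subseteq> Z" "independent c" "Z \<subseteq> span c"
    using maximal_independent_subset_extend[of "insert z b" Z] ind z b(1) B(2) by auto
  have "finite c" using independent_span_bound[OF Z(2) c(3)] c(2) Z(1) by blast
  then have "card b < card c"
    using c(1) zb by (intro psubset_card_mono) auto
  moreover have "card c = dim Z" using basis_card_eq_dim c by blast
  ultimately show "dim Z - dim B \<noteq> 0" using b(4) by simp
qed auto

interpretation coeff_space: vector_space "smult :: 'k::field \<Rightarrow> _"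
  by unfold_locales
    (rule poly_mapping_eqI, simp add: lookup_smult lookup_add distrib_left distrib_right)+

section \<open>From the support of Tor to Betti numbers\<close>

lemma boundary_imp_cycle:
  assumes X: "graded_complex X" and b: "boundary X (Suc i) j c"
  shows "cycle X (Suc i) j c"
proof -
  obtain d where d: "\<And>a. d a \<noteq> 0 \<Longrightarrow> dg X (Suc (Suc i)) a = j"
    "c = rmul (rk X (Suc (Suc i))) d (red (mt X (Suc i)))"
    using b by (auto simp: boundary_def)
  have "red (\<lambda>a. rmul (rk X (Suc i)) (mt X (Suc i) a) (mt X i)) = (\<lambda>_. 0)"
    using graded_complexD(2)[OF X, of i] by (auto simp: red_def fun_eq_iff)
  then have "rmul (rk X (Suc i)) (red (mt X (Suc i)) a) (red (mt X i)) = 0" for a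
    unfolding red_rmul by (rule fun_cong)
  then have "rmul (rk X (Suc i)) c (red (mt X i)) = 0"
    unfolding d(2) rmul_assoc by simp
  moreover have "vec (rk X (Suc i)) c"
    unfolding d(2) by (intro vec_rmul vec_red[OF graded_complexD(1)[OF X]])
  moreover have "dg X (Suc i) a = j" if "c a \<noteq> 0" for a
    using red_degree[OF graded_complexD(1)[OF X, of "Suc i"], of d j _ a] d that by simp
  ultimately show ?thesis by (auto simp: cycle_def)
qed

lemma tor_support_iff_red_homology:
  fixes F :: "('v, 'k::field) free_complex"
  assumes F: "graded_free_resolution I F" and I: "\<And>p. p \<in> I \<Longrightarrow> const_term p = 0"
  shows "red_homology_dim F i j \<noteq> 0 \<longleftrightarrow> (Suc i, j) \<in> tor_support (quot_cx F)"
proof -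
  let ?X = "quot_cx F"
  have X: "resolves ?X I" using resolves_quot_cx[OF F] .
  have part: "c \<in> red_part F i j \<longleftrightarrow> vec (rk ?X (Suc i)) (Poly_Mapping.lookup c) \<and>
      (\<forall>a. Poly_Mapping.lookup c a \<noteq> 0 \<longrightarrow> dg ?X (Suc i) a = j)" for c i
    by (auto simp: red_part_def quot_cx_simps vec_lookup_iff in_keys_iff subset_iff)
  have diff: "Poly_Mapping.lookup (red_diff F i c) =
      rmul (rk ?X (Suc (Suc i))) (Poly_Mapping.lookup c) (red (mt ?X (Suc i)))"
    if "c \<in> red_part F (Suc i) j" for i c
  proof -
    have k: "Poly_Mapping.keys c \<subseteq> {..<frank F (Suc i)}" using that by (auto simp: red_part_def)
    have "Poly_Mapping.lookup (Poly_Mapping.map const_term (diff F i a)) = red (mt ?X (Suc i)) a"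
      if "a < frank F (Suc i)" for a
      using that by (simp add: red_def quot_cx_simps fun_eq_iff map.rep_eq when_def)
    then show ?thesis unfolding red_diff_def lookup_lin_map[OF k] quot_cx_simps(2)
      by (intro rmul_cong)
  qed
  have cyc: "c \<in> red_cycles F i j \<longleftrightarrow> cycle ?X (Suc i) j (Poly_Mapping.lookup c)" for c
  proof (cases i)
    case 0
    \<comment> \<open>In position 0 \<open>red_cycles\<close> imposes no condition, whereas in
      \<open>?X\<close> the augmentation follows. The two agree because the augmentation reduces to
      0 when \<open>I\<close> has no constant terms.\<close>
    have "rmul r (Poly_Mapping.lookup c) (red (mt ?X 0)) = 0" for r
      by (simp add: red_augmentation[OF X I])
    then show ?thesis by (auto simp: red_cycles_def 0 part cycle_def)
  next
    case (Suc l)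
    have "c \<in> red_cycles F i j \<longleftrightarrow> c \<in> red_part F i j \<and>
        Poly_Mapping.lookup (red_diff F l c) = 0"
      by (auto simp: red_cycles_def Suc poly_mapping_eq_iff fun_eq_iff)
    also have "\<dots> \<longleftrightarrow> c \<in> red_part F i j \<and> rmul (rk ?X (Suc i)) (Poly_Mapping.lookup c) (red (mt ?X i)) = 0"
      using diff[of c l] by (auto simp: Suc)
    finally show ?thesis by (auto simp: part cycle_def)
  qed
  have bnd: "c \<in> red_boundaries F i j \<longleftrightarrow> boundary ?X (Suc i) j (Poly_Mapping.lookup c)" for c
  proof
    assume "c \<in> red_boundaries F i j"
    then obtain d where "d \<in> red_part F (Suc i) j" "c = red_diff F i d" by (auto simp: red_boundaries_def)
    then show "boundary ?X (Suc i) j (Poly_Mapping.lookup c)"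
      unfolding boundary_def using diff part by metis
  next
    assume "boundary ?X (Suc i) j (Poly_Mapping.lookup c)"
    then obtain d where d: "\<And>a. d a \<noteq> 0 \<Longrightarrow> dg ?X (Suc (Suc i)) a = j"
      "Poly_Mapping.lookup c = rmul (rk ?X (Suc (Suc i))) d (red (mt ?X (Suc i)))"
      by (auto simp: boundary_def)
    let ?d = "pm_of (rk ?X (Suc (Suc i))) d"
    have "?d \<in> red_part F (Suc i) j"
      using d(1) by (auto simp: part vec_def lookup_pm_of split: if_splits)
    moreover from this have "Poly_Mapping.lookup (red_diff F i ?d) = Poly_Mapping.lookup c"
      by (simp add: diff rmul_pm_of d(2))
    then have "c = red_diff F i ?d" by (metis poly_mapping.lookup_inject)
    ultimately show "c \<in> red_boundaries F i j" by (auto simp: red_boundaries_def)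
  qed
  have sub: "red_boundaries F i j \<subseteq> red_cycles F i j"
    using boundary_imp_cycle[OF resolvesD(1)[OF X]] cyc bnd by blast
  have "coeff_space.subspace (red_boundaries F i j)"
    unfolding coeff_space.subspace_def
  proof (intro conjI ballI allI)
    have "boundary ?X (Suc i) j (\<lambda>_. 0)" using boundary_0[of ?X "Suc i" j] by (simp add: zero_fun_def)
    then show "0 \<in> red_boundaries F i j" by (simp add: bnd zero_poly_mapping.rep_eq)
    fix c assume "c \<in> red_boundaries F i j"
    then obtain d where d: "\<And>a. d a \<noteq> 0 \<Longrightarrow> dg ?X (Suc (Suc i)) a = j"
      "Poly_Mapping.lookup c = rmul (rk ?X (Suc (Suc i))) d (red (mt ?X (Suc i)))"
      by (auto simp: boundary_def bnd)
    { fix c' assume "c' \<in> red_boundaries F i j"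
      then obtain d' where d': "\<And>a. d' a \<noteq> 0 \<Longrightarrow> dg ?X (Suc (Suc i)) a = j"
        "Poly_Mapping.lookup c' = rmul (rk ?X (Suc (Suc i))) d' (red (mt ?X (Suc i)))"
        by (auto simp: boundary_def bnd)
      have "Poly_Mapping.lookup (c + c') = rmul (rk ?X (Suc (Suc i))) (d + d') (red (mt ?X (Suc i)))"
        unfolding rmul_add_left d(2)[symmetric] d'(2)[symmetric] by (simp add: lookup_add fun_eq_iff)
      moreover have "dg ?X (Suc (Suc i)) a = j" if "(d + d') a \<noteq> 0" for a
        using that d(1)[of a] d'(1)[of a] by (cases "d a = 0") auto
      ultimately show "c + c' \<in> red_boundaries F i j" unfolding bnd boundary_def by blast }
    fix k
    have "Poly_Mapping.lookup (smult k c) = rmul (rk ?X (Suc (Suc i))) (\<lambda>a. k * d a) (red (mt ?X (Suc i)))"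
      unfolding rmul_scale_left d(2)[symmetric] by (simp add: lookup_smult fun_eq_iff)
    moreover have "dg ?X (Suc (Suc i)) a = j" if "k * d a \<noteq> 0" for a
      using that d(1)[of a] by auto
    ultimately show "smult k c \<in> red_boundaries F i j"
      unfolding bnd boundary_def by (intro exI[of _ "\<lambda>a. k * d a"] conjI allI impI)
  qed
  moreover have "red_cycles F i j \<subseteq> coeff_space.span ((\<lambda>a. Poly_Mapping.single a 1) ` {..<frank F i})"
  proof
    fix c assume "c \<in> red_cycles F i j"
    then have c: "Poly_Mapping.keys c \<subseteq> {..<frank F i}"
      by (auto simp: cyc cycle_def vec_lookup_iff quot_cx_simps)
    have "c = (\<Sum>a\<in>Poly_Mapping.keys c. smult (Poly_Mapping.lookup c a) (Poly_Mapping.single a 1))"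
      by (rule poly_mapping_eqI)
        (simp add: lookup_sum lookup_smult lookup_single when_def in_keys_iff if_distrib cong: if_cong)
    also have "\<dots> \<in> coeff_space.span ((\<lambda>a. Poly_Mapping.single a 1) ` {..<frank F i})"
      using c by (intro coeff_space.span_sum coeff_space.span_scale coeff_space.span_base) auto
    finally show "c \<in> coeff_space.span ((\<lambda>a. Poly_Mapping.single a 1) ` {..<frank F i})" .
  qed
  ultimately have "red_homology_dim F i j \<noteq> 0 \<longleftrightarrow> red_boundaries F i j \<noteq> red_cycles F i j"
    unfolding red_homology_dim_def using sub by (intro coeff_space.dim_diff_neq_0_iff) auto
  also have "\<dots> \<longleftrightarrow> (\<exists>c. c \<in> red_cycles F i j \<and> c \<notin> red_boundaries F i j)" using sub by blast
  also have "\<dots> \<longleftrightarrow> (\<exists>c. cycle ?X (Suc i) j c \<and> \<not> boundary ?X (Suc i) j c)"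
  proof
    assume "\<exists>c. cycle ?X (Suc i) j c \<and> \<not> boundary ?X (Suc i) j c"
    then obtain c where c: "cycle ?X (Suc i) j c" "\<not> boundary ?X (Suc i) j c" by blast
    then have "Poly_Mapping.lookup (pm_of (rk ?X (Suc i)) c) = c"
      by (simp add: cycle_def lookup_pm_of_vec)
    then show "\<exists>c. c \<in> red_cycles F i j \<and> c \<notin> red_boundaries F i j" using c cyc bnd by metis
  qed (use cyc bnd in blast)
  finally show ?thesis by (simp add: tor_support_def)
qed

text \<open>Whatever resolution \<open>betti\<close> picks, its support is that of every other one;
  the index moves by one as Tor_i(I, k) is Tor_(i+1)(R / I, k).\<close>

lemma betti_neq_0_iff:
  fixes X :: "('v::finite, 'k::field) mpoly cx"
  assumes X: "resolves X I" and I: "\<And>p. p \<in> I \<Longrightarrow> const_term p = 0"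
  shows "betti I i j \<noteq> 0 \<longleftrightarrow> (Suc i, j) \<in> tor_quot I"
proof -
  let ?F = "SOME F. graded_free_resolution I F"
  have F: "graded_free_resolution I ?F"
    using graded_free_resolution_exists[OF X] by (rule someI_ex)
  show ?thesis
    using tor_support_iff_red_homology[OF F I] tor_quot_eq[OF resolves_quot_cx[OF F]]
    by (simp only: betti_def)
qed

lemma mono_dvd_0_right: "mono_dvd t 0 \<Longrightarrow> t = 0"
  by (auto simp: mono_dvd_def) (metis mono_add_eq_0)

lemma const_term_monomial_ideal:
  assumes "0 \<notin> T" "p \<in> ideal_gen (monom ` T)"
  shows "const_term p = 0"
proof (rule ccontr)
  assume "const_term p \<noteq> 0"
  then have "0 \<in> Poly_Mapping.keys p" by (simp add: in_keys_iff)
  then obtain t where "t \<in> T" "mono_dvd t 0" using assms(2) unfolding monomial_span_iff by blast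
  then show False using assms(1) mono_dvd_0_right by blast
qed

lemma ideal_gen_monom_eqI:
  assumes "\<And>s. s \<in> S \<Longrightarrow> \<exists>t\<in>T. mono_dvd t s" "\<And>t. t \<in> T \<Longrightarrow> \<exists>s\<in>S. mono_dvd s t"
  shows "ideal_gen (monom ` S) = (ideal_gen (monom ` T) :: ('v, 'k::field) mpoly set)"
  unfolding set_eq_iff monomial_span_iff using assms mono_dvd_trans by meson

text \<open>\<open>0 \<notin> T\<close> says that 1 is not among the generators, so that all
  elements of the ideal have constant term 0.\<close>

lemma tor_quot_monomial_ideal:
  fixes T :: "'v::finite mono set" and I :: "('v, 'k::field) mpoly set"
  assumes T: "finite T" "0 \<notin> T" and I: "I = ideal_gen (monom ` T)"
  shows "finite (tor_quot I)" "(0, j) \<in> tor_quot I \<longleftrightarrow> j = 0"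
    "I \<noteq> {0} \<Longrightarrow> \<exists>d\<ge>1. (1, d) \<in> tor_quot I" "I = {0} \<Longrightarrow> tor_quot I = {(0, 0)}"
    "betti I i j \<noteq> 0 \<longleftrightarrow> (Suc i, j) \<in> tor_quot I"
proof -
  obtain X :: "('v, 'k) mpoly cx" and N where X: "resolves X I" "\<forall>i\<ge>N. rk X i = 0"
    using monomial_resolution_exists[OF T(1) order_refl] I by blast
  have c: "const_term p = 0" if "p \<in> I" for p
    using that const_term_monomial_ideal[OF T(2)] unfolding I by blast
  show "finite (tor_quot I)" using finite_tor_support[OF X(2)] tor_quot_eq[OF X(1)] by simp
  show 0: "(0, j) \<in> tor_quot I \<longleftrightarrow> j = 0" for j using tor_support_0[OF X(1) c] tor_quot_eq[OF X(1)] by simp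
  show "\<exists>d\<ge>1. (1, d) \<in> tor_quot I" if "I \<noteq> {0}"
    using tor_support_1[OF X(1) c that] tor_quot_eq[OF X(1)] by simp
  show "betti I i j \<noteq> 0 \<longleftrightarrow> (Suc i, j) \<in> tor_quot I" using betti_neq_0_iff[OF X(1) c] .
  show "tor_quot I = {(0, 0)}" if "I = {0}"
  proof -
    let ?Z = "zero_complex :: ('v, 'k) mpoly cx"
    have Z: "tor_quot I = tor_support ?Z"
      unfolding that by (rule tor_quot_eq[OF resolves_zero_complex])
    have "(Suc i, j) \<notin> tor_support ?Z" for i j
    proof
      assume "(Suc i, j) \<in> tor_support ?Z"
      then obtain c where c: "cycle ?Z (Suc i) j c" "\<not> boundary ?Z (Suc i) j c"
        by (auto simp: tor_support_def)
      from c(1) have "c = 0" by (auto simp: cycle_def vec_def zero_complex_def fun_eq_iff)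
      then show False using c(2) by simp
    qed
    then have "p \<in> tor_quot I \<longleftrightarrow> p = (0, 0)" for p
      using 0 by (cases p; cases "fst p") (auto simp: Z)
    then show ?thesis by blast
  qed
qed

section \<open>Regularity and projective dimension read off from R / I\<close>

definition max_reg :: "(nat \<times> int) set \<Rightarrow> int" where
  "max_reg Q = Max ((\<lambda>(i, j). j - int i) ` Q)"

definition max_pd :: "(nat \<times> int) set \<Rightarrow> int" where
  "max_pd Q = Max ((\<lambda>(i, j). int i) ` Q)"

text \<open>For the zero ideal the support {(0, 0)} gives exactly the conventional values. For other
  ideals the passage from R / I to I forgets position 0, and the pair \<open>(1, d)\<close> with
  \<open>d \<ge> 1\<close> prevents a maximum from being lost.\<close>

lemma reg_pd_eq:
  fixes T :: "'v::finite mono set" and I :: "('v, 'k::field) mpoly set"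
  assumes T: "finite T" "0 \<notin> T" and I: "I = ideal_gen (monom ` T)"
  shows "reg I = max_reg (tor_quot I) + 1" "pd I = max_pd (tor_quot I) - 1"
proof -
  note Q = tor_quot_monomial_ideal[OF T I]
  have "reg I = max_reg (tor_quot I) + 1 \<and> pd I = max_pd (tor_quot I) - 1"
  proof (cases "I = {0}")
    case True
    then show ?thesis using Q(4) by (simp add: reg_def pd_def max_reg_def max_pd_def)
  next
    case False
    then obtain d where d: "d \<ge> 1" "(1, d) \<in> tor_quot I" using Q(3) by blast
    have B: "0 < betti I i j \<longleftrightarrow> (Suc i, j) \<in> tor_quot I" for i j
      using Q(5)[of i j] by simp
    have bound: "j - int i \<le> max_reg (tor_quot I)" "int i \<le> max_pd (tor_quot I)"
      if "(i, j) \<in> tor_quot I" for i j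
      unfolding max_reg_def max_pd_def using that Q(1) by (auto intro!: Max_ge)
    have ne: "tor_quot I \<noteq> {}" using d by blast
    have fin: "finite {(i, j). (Suc i, j) \<in> tor_quot I}"
      using finite_imageI[OF Q(1), of "\<lambda>(i, j). (i - 1, j)"] by (rule finite_subset[rotated]) force
    have "Max {j - int i | i j. betti I i j \<noteq> 0} = max_reg (tor_quot I) + 1"
    proof (rule Max_eqI)
      have "{j - int i | i j. betti I i j \<noteq> 0} = (\<lambda>(i, j). j - int i) ` {(i, j). (Suc i, j) \<in> tor_quot I}"
        by (auto simp: B)
      then show "finite {j - int i | i j. betti I i j \<noteq> 0}" using fin by simp
      show "y \<le> max_reg (tor_quot I) + 1" if "y \<in> {j - int i | i j. betti I i j \<noteq> 0}" for y
        using that bound(1) by (fastforce simp: B)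
      have "max_reg (tor_quot I) \<in> (\<lambda>(i, j). j - int i) ` tor_quot I"
        unfolding max_reg_def using Q(1) ne by (intro Max_in) auto
      then obtain i j where ij: "(i, j) \<in> tor_quot I" "max_reg (tor_quot I) = j - int i" by auto
      \<comment> \<open>If the maximum is attained in position 0, it is 0; then \<open>d\<close> is
        1 and the pair \<open>(1, d)\<close> attains it as well.\<close>
      have "\<exists>i j. (Suc i, j) \<in> tor_quot I \<and> max_reg (tor_quot I) = j - int (Suc i)"
      proof (cases i)
        case 0
        then have "max_reg (tor_quot I) = 0" using ij Q(2) by simp
        moreover have "d - 1 \<le> max_reg (tor_quot I)" using bound(1)[OF d(2)] by simp
        ultimately show ?thesis using d by (intro exI[of _ 0] exI[of _ d]) simp
      qed (use ij in blast)
      then show "max_reg (tor_quot I) + 1 \<in> {j - int i | i j. betti I i j \<noteq> 0}"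
        by (force simp: B)
    qed
    moreover have "Max {int i | i j. betti I i j \<noteq> 0} = max_pd (tor_quot I) - 1"
    proof (rule Max_eqI)
      have "{int i | i j. betti I i j \<noteq> 0} = (\<lambda>(i, j). int i) ` {(i, j). (Suc i, j) \<in> tor_quot I}"
        by (auto simp: B)
      then show "finite {int i | i j. betti I i j \<noteq> 0}" using fin by simp
      show "y \<le> max_pd (tor_quot I) - 1" if "y \<in> {int i | i j. betti I i j \<noteq> 0}" for y
        using that bound(2) by (fastforce simp: B)
      have "max_pd (tor_quot I) \<in> (\<lambda>(i, j). int i) ` tor_quot I"
        unfolding max_pd_def using Q(1) ne by (intro Max_in) auto
      then obtain i j where ij: "(i, j) \<in> tor_quot I" "max_pd (tor_quot I) = int i" by auto
      moreover have "1 \<le> max_pd (tor_quot I)" using bound(2)[OF d(2)] by simp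
      ultimately obtain l where "i = Suc l" by (cases i) auto
      then show "max_pd (tor_quot I) - 1 \<in> {int i | i j. betti I i j \<noteq> 0}"
        using ij by (auto simp: B)
    qed
    ultimately show ?thesis using False by (simp add: reg_def pd_def)
  qed
  then show "reg I = max_reg (tor_quot I) + 1" "pd I = max_pd (tor_quot I) - 1" by auto
qed

text \<open>Raising positions by 1 and degrees by \<open>e\<close> changes \<open>j - i\<close> by
  \<open>e - 1\<close>. This is 1 for the edge uv and 0 for a variable.\<close>

lemma max_reg_pd_union:
  assumes "finite Q" "Q \<noteq> {}" "finite P" "P \<noteq> {}"
  shows "max_reg (Q \<union> {(Suc i, j + e) | i j. (i, j) \<in> P}) = max (max_reg Q) (max_reg P + (e - 1))"
    "max_pd (Q \<union> {(Suc i, j + e) | i j. (i, j) \<in> P}) = max (max_pd Q) (max_pd P + 1)"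
proof -
  have shift: "Max ((\<lambda>x. x + c) ` A) = Max A + c" if "finite A" "A \<noteq> {}" for A :: "int set" and c
    using mono_Max_commute[of "\<lambda>x. x + c" A] that by (simp add: mono_def)
  have S: "{(Suc i, j + e) | i j. (i, j) \<in> P} = (\<lambda>(i, j). (Suc i, j + e)) ` P" by auto
  have "(\<lambda>(i, j). j - int i) ` (\<lambda>(i, j). (Suc i, j + e)) ` P = (\<lambda>x. x + (e - 1)) ` (\<lambda>(i, j). j - int i) ` P"
    unfolding image_image by (rule image_cong) auto
  then show "max_reg (Q \<union> {(Suc i, j + e) | i j. (i, j) \<in> P}) = max (max_reg Q) (max_reg P + (e - 1))"
    unfolding max_reg_def S image_Un using assms by (simp only:) (subst Max_Un, auto simp: shift)
  have "(\<lambda>(i, j). int i) ` (\<lambda>(i, j). (Suc i, j + e)) ` P = (\<lambda>x. x + 1) ` (\<lambda>(i, j). int i) ` P"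
    unfolding image_image by (rule image_cong) auto
  then show "max_pd (Q \<union> {(Suc i, j + e) | i j. (i, j) \<in> P}) = max (max_pd Q) (max_pd P + 1)"
    unfolding max_pd_def S image_Un using assms by (simp only:) (subst Max_Un, auto simp: shift)
qed

section \<open>Adjoining a monomial or a set of variables\<close>

abbreviation vmon :: "'v \<Rightarrow> 'v mono" where
  "vmon x \<equiv> Poly_Mapping.single x (Suc 0)"

lemma vmon_neq_0 [simp]: "vmon x \<noteq> 0" "vmon x + s \<noteq> 0"
proof -
  show "vmon x \<noteq> 0" by (metis lookup_single_eq lookup_zero nat.simps(3))
  then show "vmon x + s \<noteq> 0" by (simp add: mono_add_eq_0)
qed

text \<open>\<open>tor_support_adjoin\<close> with the variable x for w and the monomial s for z,
  its hypotheses put as divisibility of exponents. \<open>L\<close> may be any finite generating set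
  of the colon ideal, which later permits one adapted to H.\<close>

lemma tor_quot_insert:
  fixes T L :: "'v::finite mono set"
  assumes T: "finite T" and L: "finite L"
    and colon: "ideal_gen (monom ` L) = (ideal_gen (monom ` (\<lambda>t. t - (vmon x + s)) ` T) :: ('v, 'k::field) mpoly set)"
    and s: "\<And>l. l \<in> L \<Longrightarrow> \<exists>t\<in>T. mono_dvd t (s + l)"
  shows "tor_quot (ideal_gen (monom ` insert (vmon x + s) T) :: ('v, 'k) mpoly set) =
    tor_quot (ideal_gen (monom ` T) :: ('v, 'k) mpoly set) \<union>
    {(Suc i, j + (1 + int (mono_deg s))) | i j. (i, j) \<in> tor_quot (ideal_gen (monom ` L) :: ('v, 'k) mpoly set)}"
proof -
  obtain X :: "('v, 'k) mpoly cx" where X: "resolves X (ideal_gen (monom ` T))"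
    using monomial_resolution_exists[OF T order_refl] by blast
  obtain P :: "('v, 'k) mpoly cx" where P: "resolves P (ideal_gen (monom ` L))"
    using monomial_resolution_exists[OF L order_refl] by blast
  have w: "homogeneous (monom (vmon x) :: ('v, 'k) mpoly) 1" "const_term (monom (vmon x) :: ('v, 'k) mpoly) = 0"
    using homogeneous_monom[of "vmon x"] vmon_neq_0(1)[of x]
    by (auto simp: monom_def lookup_single when_def simp del: vmon_neq_0)
  have Ls: "p * monom s \<in> ideal_gen (monom ` T)" if p: "p \<in> ideal_gen (monom ` L)" for p :: "('v, 'k) mpoly"
    unfolding monomial_span_iff mult.commute[of p] keys_monom_mult
  proof clarify
    fix r assume "r \<in> Poly_Mapping.keys p"
    then obtain l where "l \<in> L" "mono_dvd l r" using p unfolding monomial_span_iff by blast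
    then obtain t where "t \<in> T" "mono_dvd t (s + l)" "mono_dvd (s + l) (s + r)"
      using s by (force simp: mono_dvd_iff lookup_add)
    then show "\<exists>t\<in>T. mono_dvd t (s + r)" using mono_dvd_trans by blast
  qed
  have "\<exists>C :: ('v, 'k) mpoly cx. resolves C {b + c * (monom (vmon x) * monom s) | b c. b \<in> ideal_gen (monom ` T)} \<and>
    tor_support C = tor_support X \<union> {(Suc i, j + (1 + int (mono_deg s))) | i j. (i, j) \<in> tor_support P}"
  proof (rule tor_support_adjoin[OF P X w homogeneous_monom])
    show "p \<in> ideal_gen (monom ` L) \<longleftrightarrow> p * (monom (vmon x) * monom s) \<in> ideal_gen (monom ` T)"
      for p :: "('v, 'k) mpoly"
      unfolding monom_add[symmetric] monomial_colon colon ..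
  qed (rule Ls)
  then obtain C :: "('v, 'k) mpoly cx" where C: "resolves C (ideal_gen (monom ` insert (vmon x + s) T))"
    "tor_support C = tor_support X \<union> {(Suc i, j + (1 + int (mono_deg s))) | i j. (i, j) \<in> tor_support P}"
    by (auto simp: monom_add[symmetric] ideal_gen_insert)
  show ?thesis unfolding tor_quot_eq[OF C(1)] tor_quot_eq[OF X] tor_quot_eq[OF P] C(2) ..
qed



lemma max_reg_pd_adjoin_vars:
  fixes T :: "'v::finite mono set"
  assumes "finite Y" "finite T" "0 \<notin> T" "\<And>y t. y \<in> Y \<Longrightarrow> t \<in> T \<Longrightarrow> Poly_Mapping.lookup t y = 0"
  defines "I \<equiv> ideal_gen (monom ` T) :: ('v, 'k::field) mpoly set"
  defines "L \<equiv> \<lambda>Y. ideal_gen (monom ` (vmon ` Y \<union> T)) :: ('v, 'k::field) mpoly set"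
  shows "max_reg (tor_quot (L Y)) = max_reg (tor_quot I) \<and>
    max_pd (tor_quot (L Y)) = max_pd (tor_quot I) + int (card Y)"
  using assms(1,4)
proof (induction Y)
  case empty
  then show ?case by (simp add: L_def I_def)
next
  case (insert y Y)
  let ?T = "vmon ` Y \<union> T"
  have fin: "finite ?T" using insert.hyps(1) assms(2) by simp
  have nz: "0 \<notin> ?T" using assms(3) vmon_neq_0(1) by (auto dest: sym)
  have y: "Poly_Mapping.lookup t y = 0" if "t \<in> ?T" for t
    using that insert.hyps(2) insert.prems by (auto simp: lookup_single when_def)
  \<comment> \<open>No generator involves y, so the ideal equals its own colon ideal by y and both
    parts of the union come from it.\<close>
  have "t - vmon y = t" if "t \<in> ?T" for t
    using y[OF that] by (intro poly_mapping_eqI) (auto simp: lookup_minus lookup_single when_def)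
  then have colon: "(\<lambda>t. t - (vmon y + 0)) ` ?T = ?T" by simp
  have "tor_quot (ideal_gen (monom ` insert (vmon y + 0) ?T) :: ('v, 'k) mpoly set) =
    tor_quot (L Y) \<union> {(Suc i, j + (1 + int (mono_deg (0 :: 'v mono)))) | i j. (i, j) \<in> tor_quot (L Y)}"
    unfolding L_def
  proof (intro tor_quot_insert fin)
    show "\<exists>t\<in>?T. mono_dvd t (0 + l)" if "l \<in> ?T" for l
      using that by (intro bexI[of _ l]) simp_all
  qed (simp only: colon)
  then have Q: "tor_quot (L (insert y Y)) = tor_quot (L Y) \<union> {(Suc i, j + 1) | i j. (i, j) \<in> tor_quot (L Y)}"
    by (simp add: L_def)
  have "(0, 0) \<in> tor_quot (L Y)" "finite (tor_quot (L Y))"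
    using tor_quot_monomial_ideal[OF fin nz] unfolding L_def by blast+
  then have "max_reg (tor_quot (L (insert y Y))) = max_reg (tor_quot (L Y))"
    "max_pd (tor_quot (L (insert y Y))) = max_pd (tor_quot (L Y)) + 1"
    unfolding Q using max_reg_pd_union[of "tor_quot (L Y)" "tor_quot (L Y)" 1] by auto
  then show ?case using insert by auto
qed

section \<open>Edge ideals\<close>

definition edge_monos :: "'v graph \<Rightarrow> 'v mono set" where
  "edge_monos G = {vmon x + vmon y | x y. {x, y} \<in> edges G}"

lemma edge_ideal_eq: "edge_ideal G = (ideal_gen (monom ` edge_monos G) :: ('v, 'k::field) mpoly set)"
proof -
  have "{var x * var y | x y. {x, y} \<in> edges G} = (monom ` edge_monos G :: ('v, 'k) mpoly set)"
    by (force simp: edge_monos_def var_def monom_add[symmetric] image_iff)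
  then show ?thesis by (simp add: edge_ideal_def)
qed

lemma finite_edge_monos: "finite (edge_monos G)" for G :: "'v::finite graph"
proof -
  have "edge_monos G \<subseteq> (\<lambda>(x, y). vmon x + vmon y) ` UNIV" by (auto simp: edge_monos_def)
  then show ?thesis by (rule finite_subset) simp
qed

lemma edge_monos_nonzero: "0 \<notin> edge_monos G"
  using vmon_neq_0(2) by (auto simp: edge_monos_def dest: sym)

section \<open>Edge monomials; minimal generators, lcms and intersections\<close>

lemma keys_vmon_add: "Poly_Mapping.keys (vmon x + vmon y) = {x, y}"
  by (auto simp: in_keys_iff lookup_add lookup_single when_def split: if_splits)

lemma vmon_add_eq_iff: "vmon x + vmon y = vmon a + vmon b \<Longrightarrow> {x, y} = {a, b}"
  by (metis keys_vmon_add)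

text \<open>The \<open>THE\<close> in \<open>min_gens\<close> asks for uniqueness of an
  inclusion-minimal generating set. The monomials of \<open>T\<close> minimal under divisibility
  generate the ideal and lie in every monomial generating set of it.\<close>

lemma min_gens_monomial:
  fixes T :: "'v::finite mono set"
  shows "min_gens (ideal_gen (monom ` T) :: ('v, 'k::field) mpoly set) =
    {t \<in> T. \<forall>t'\<in>T. mono_dvd t' t \<longrightarrow> t' = t}" (is "min_gens ?I = ?M")
proof -
  have M: "ideal_gen (monom ` ?M) = ?I"
  proof (rule ideal_gen_monom_eqI)
    fix t assume t: "t \<in> T"
    \<comment> \<open>Among the divisors of \<open>t\<close> in \<open>T\<close>, one of least
      degree is minimal under divisibility.\<close>
    define n where "n = (LEAST n. \<exists>t'\<in>T. mono_dvd t' t \<and> mono_deg t' = n)"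
    have "\<exists>t'\<in>T. mono_dvd t' t \<and> mono_deg t' = n"
      unfolding n_def by (rule LeastI_ex) (use t in \<open>auto intro: mono_dvd_refl\<close>)
    then obtain t' where t': "t' \<in> T" "mono_dvd t' t" "mono_deg t' = n" by blast
    have "r = t'" if r: "r \<in> T" "mono_dvd r t'" for r
    proof (rule mono_dvd_deg_eq[OF r(2)])
      have "mono_dvd r t" using r(2) t'(2) by (rule mono_dvd_trans)
      then show "mono_deg t' \<le> mono_deg r"
        unfolding t'(3) n_def by (intro Least_le) (use r(1) in blast)
    qed
    then show "\<exists>s\<in>?M. mono_dvd s t" using t' by blast
  qed (auto intro: mono_dvd_refl)
  have sub: "?M \<subseteq> S" if S: "ideal_gen (monom ` S) = ?I" for S
  proof
    fix t assume t: "t \<in> ?M"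
    then have "monom t \<in> ?I" unfolding monom_in_span_iff using mono_dvd_refl by blast
    then obtain s where s: "s \<in> S" "mono_dvd s t" unfolding S[symmetric] monom_in_span_iff by blast
    then have "monom s \<in> ?I" unfolding S[symmetric] monom_in_span_iff using mono_dvd_refl by blast
    then obtain r where r: "r \<in> T" "mono_dvd r s" unfolding monom_in_span_iff by blast
    then have "r = t" using t s(2) mono_dvd_trans by blast
    then show "t \<in> S" using mono_dvd_antisym[OF s(2)] r(2) s(1) by simp
  qed
  show ?thesis
    unfolding min_gens_def
  proof (rule the_equality)
    show "ideal_gen (monom ` ?M) = ?I \<and> (\<forall>S'. S' \<subset> ?M \<longrightarrow> ideal_gen (monom ` S') \<noteq> ?I)"
      using M sub by blast
    show "S = ?M" if "ideal_gen (monom ` S) = ?I \<and> (\<forall>S'. S' \<subset> S \<longrightarrow> ideal_gen (monom ` S') \<noteq> ?I)" for S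
      using that sub[of S] M by blast
  qed
qed

text \<open>With truncated subtraction \<open>s + (t - s)\<close> is the pointwise maximum of the
  exponents.\<close>

lemma mono_lcm_pair: "mono_lcm {s, t} = s + (t - s)"
  unfolding mono_lcm_def
proof (rule the_equality)
  have *: "mono_dvd (s + (t - s)) m \<longleftrightarrow> mono_dvd s m \<and> mono_dvd t m" for m
  proof -
    have "a + (b - a) \<le> c \<longleftrightarrow> a \<le> c \<and> b \<le> c" for a b c :: nat by linarith
    then show ?thesis by (auto simp: mono_dvd_iff lookup_add lookup_minus)
  qed
  show "(\<forall>r\<in>{s, t}. mono_dvd r (s + (t - s))) \<and>
      (\<forall>m'. (\<forall>r\<in>{s, t}. mono_dvd r m') \<longrightarrow> mono_dvd (s + (t - s)) m')"
    using *[of "s + (t - s)"] * by simp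
  fix m assume m: "(\<forall>r\<in>{s, t}. mono_dvd r m) \<and> (\<forall>m'. (\<forall>r\<in>{s, t}. mono_dvd r m') \<longrightarrow> mono_dvd m m')"
  show "m = s + (t - s)"
    using m * *[of "s + (t - s)"] by (intro mono_dvd_antisym) auto
qed

lemma monomial_ideal_Int:
  "ideal_gen (monom ` {m}) \<inter> ideal_gen (monom ` T) =
    (ideal_gen (monom ` (\<lambda>t. m + (t - m)) ` T) :: ('v, 'k::field) mpoly set)"
proof -
  have "mono_dvd (m + (t - m)) s \<longleftrightarrow> mono_dvd m s \<and> mono_dvd t s" for t s :: "'v mono"
  proof -
    have "a + (b - a) \<le> c \<longleftrightarrow> a \<le> c \<and> b \<le> c" for a b c :: nat by linarith
    then show ?thesis by (auto simp: mono_dvd_iff lookup_add lookup_minus)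
  qed
  then show ?thesis unfolding set_eq_iff Int_iff monomial_span_iff by auto
qed

lemma edge_mono_iff: "vmon a + vmon b \<in> edge_monos G \<longleftrightarrow> {a, b} \<in> edges G"
proof
  assume "vmon a + vmon b \<in> edge_monos G"
  then obtain x y where "{x, y} \<in> edges G" "vmon a + vmon b = vmon x + vmon y"
    by (auto simp: edge_monos_def)
  then show "{a, b} \<in> edges G" using vmon_add_eq_iff by metis
qed (auto simp: edge_monos_def)

text \<open>If \<open>x\<close> were a neighbour of \<open>u\<close> only and \<open>y\<close> one of \<open>v\<close> only, then \<open>\<psi>\<close> would be forced to map
  the generators \<open>uvx\<close> and \<open>uvy\<close> of \<open>J \<inter> K\<close> to \<open>ux\<close> and \<open>vy\<close>, whose lcm is that of \<open>uvx\<close> and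
  \<open>uvy\<close>.\<close>

lemma splitting_edge_nbrs:
  fixes G :: "'v::finite graph"
  assumes G: "simple_graph G" and split: "splitting_edge TYPE('k::field) G u v"
  shows "nbrs G u - {v} \<subseteq> nbrs G v \<or> nbrs G v - {u} \<subseteq> nbrs G u"
proof (rule ccontr)
  assume "\<not> ?thesis"
  then obtain x y where x: "{u, x} \<in> edges G" "x \<noteq> v" "{v, x} \<notin> edges G"
    and y: "{v, y} \<in> edges G" "y \<noteq> u" "{u, y} \<notin> edges G"
    by (auto simp: nbrs_def)
  have card2: "a \<noteq> b" if "{a, b} \<in> edges G" for a b
    using G that by (auto simp: simple_graph_def dest!: bspec)
  have uv: "{u, v} \<in> edges G" using split by (simp add: splitting_edge_def)
  have ne: "u \<noteq> v" "x \<noteq> u" "y \<noteq> v" "x \<noteq> y"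
    using card2[OF uv] card2[OF x(1)] card2[OF y(1)] x y by auto
  let ?K = "del_edge G {u, v}" and ?m = "vmon u + vmon v"
  have eK: "{a, b} \<in> edges ?K \<longleftrightarrow> {a, b} \<in> edges G \<and> {a, b} \<noteq> {u, v}" for a b
    by (simp add: del_edge_def)
  have J: "ideal_gen {var u * var v} = (ideal_gen (monom ` {?m}) :: ('v, 'k) mpoly set)"
    by (simp add: var_def monom_add)
  let ?W = "(\<lambda>t. ?m + (t - ?m)) ` edge_monos ?K"
  have genJ: "min_gens (ideal_gen {var u * var v} :: ('v, 'k) mpoly set) = {?m}"
    unfolding J min_gens_monomial by auto
  have genK: "min_gens (edge_ideal ?K :: ('v, 'k) mpoly set) \<subseteq> edge_monos ?K"
    unfolding edge_ideal_eq min_gens_monomial by blast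
  have genJK: "min_gens (ideal_gen {var u * var v} \<inter> edge_ideal ?K :: ('v, 'k) mpoly set) =
      {t \<in> ?W. \<forall>t'\<in>?W. mono_dvd t' t \<longrightarrow> t' = t}"
    unfolding J edge_ideal_eq monomial_ideal_Int min_gens_monomial ..
  \<comment> \<open>An edge other than uv contributes a further variable to its lcm with uv. So the
    generators of the intersection have degree at least 3, and those of the form uvz are
    minimal.\<close>
  have deg3: "3 \<le> mono_deg w" if w: "w \<in> ?W" for w
  proof -
    obtain a b where ab: "{a, b} \<in> edges ?K" "w = ?m + (vmon a + vmon b - ?m)"
      using w by (auto simp: edge_monos_def)
    have "vmon a + vmon b - ?m \<noteq> 0"
    proof
      assume "vmon a + vmon b - ?m = 0"
      then have "mono_dvd (vmon a + vmon b) ?m"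
        unfolding mono_dvd_iff by (metis diff_is_0_eq lookup_minus lookup_zero)
      then have "vmon a + vmon b = ?m" by (rule mono_dvd_deg_eq) (simp add: mono_deg_add)
      then show False using vmon_add_eq_iff[of a b u v] ab(1) eK by blast
    qed
    then have "mono_deg (vmon a + vmon b - ?m) \<noteq> 0" using mono_deg_eq_0 by blast
    then show ?thesis by (simp add: ab(2) mono_deg_add)
  qed
  have min_gen: "?m + vmon z \<in> min_gens (ideal_gen {var u * var v} \<inter> edge_ideal ?K :: ('v, 'k) mpoly set)"
    if "vmon a + vmon z \<in> edge_monos ?K" "a \<in> {u, v}" "z \<noteq> u" "z \<noteq> v" for a z
  proof -
    have eq: "?m + (vmon a + vmon z - ?m) = ?m + vmon z"
      using that(2-) ne by (intro poly_mapping_eqI) (auto simp: lookup_add lookup_minus lookup_single when_def)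
    have "?m + vmon z \<in> ?W" by (rule image_eqI, rule eq[symmetric], rule that(1))
    moreover have "w = ?m + vmon z" if "w \<in> ?W" "mono_dvd w (?m + vmon z)" for w
      by (rule mono_dvd_deg_eq[OF that(2)]) (use deg3[OF that(1)] in \<open>simp add: mono_deg_add\<close>)
    ultimately show ?thesis unfolding genJK by blast
  qed
  define w1 w2 where "w1 = ?m + vmon x" and "w2 = ?m + vmon y"
  have w1: "w1 \<in> min_gens (ideal_gen {var u * var v} \<inter> edge_ideal ?K :: ('v, 'k) mpoly set)"
    unfolding w1_def using x ne eK by (intro min_gen[of u]) (auto simp: edge_mono_iff doubleton_eq_iff)
  have w2: "w2 \<in> min_gens (ideal_gen {var u * var v} \<inter> edge_ideal ?K :: ('v, 'k) mpoly set)"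
    unfolding w2_def using y ne eK by (intro min_gen[of v]) (auto simp: edge_mono_iff doubleton_eq_iff)
  \<comment> \<open>Dividing the lcm of uv and \<open>t\<close> by uv leaves z, so the edge
    \<open>t\<close> consists of z and one of u, v.\<close>
  have only: "t = vmon u + vmon z \<and> {u, z} \<in> edges G \<or> t = vmon v + vmon z \<and> {v, z} \<in> edges G"
    if t: "t \<in> edge_monos ?K" "w = ?m + (t - ?m)" "w = ?m + vmon z" and z: "z \<noteq> u" "z \<noteq> v" for t z w
  proof -
    obtain a b where ab: "{a, b} \<in> edges ?K" "t = vmon a + vmon b"
      using t(1) by (auto simp: edge_monos_def)
    have G': "{a, b} \<in> edges G" "a \<noteq> b" using ab(1) eK card2 by blast+
    have *: "vmon z = t - ?m" using t(3) unfolding t(2) by simp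
    have l: "Poly_Mapping.lookup (vmon z) c = Poly_Mapping.lookup t c - Poly_Mapping.lookup ?m c" for c
      unfolding * lookup_minus ..
    have "z \<in> {a, b}" using l[of z] by (auto simp: ab(2) lookup_add lookup_single when_def split: if_splits)
    moreover have "c \<in> {u, v, z}" if "c \<in> {a, b}" for c
      using l[of c] that G'(2) by (auto simp: ab(2) lookup_add lookup_single when_def split: if_splits)
    ultimately consider "z = a" "b \<in> {u, v}" | "z = b" "a \<in> {u, v}" using G'(2) by blast
    then show ?thesis
    proof cases
      case 1
      then show ?thesis using G'(1) add.commute[of "vmon a"] by (auto simp: ab(2) insert_commute)
    next
      case 2
      then show ?thesis using G'(1) by (auto simp: ab(2))
    qed
  qed
  let ?JK = "ideal_gen {var u * var v} \<inter> edge_ideal ?K :: ('v, 'k) mpoly set"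
  have "is_splitting (edge_ideal G :: ('v, 'k) mpoly set) (ideal_gen {var u * var v}) (edge_ideal ?K)"
    using split by (simp only: splitting_edge_def)
  then have "\<exists>\<phi> \<psi>.
      (\<forall>w\<in>min_gens ?JK. \<phi> w \<in> min_gens (ideal_gen {var u * var v} :: ('v, 'k) mpoly set) \<and>
        \<psi> w \<in> min_gens (edge_ideal ?K :: ('v, 'k) mpoly set) \<and> w = mono_lcm {\<phi> w, \<psi> w}) \<and>
      (\<forall>S. S \<subseteq> min_gens ?JK \<and> S \<noteq> {} \<longrightarrow>
        mono_sdvd (mono_lcm (\<phi> ` S)) (mono_lcm S) \<and> mono_sdvd (mono_lcm (\<psi> ` S)) (mono_lcm S))"
    unfolding is_splitting_def by (elim conjE)
  then obtain \<phi> \<psi> where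
    \<phi>\<psi>: "\<forall>w\<in>min_gens ?JK. \<phi> w \<in> min_gens (ideal_gen {var u * var v} :: ('v, 'k) mpoly set) \<and>
      \<psi> w \<in> min_gens (edge_ideal ?K :: ('v, 'k) mpoly set) \<and> w = mono_lcm {\<phi> w, \<psi> w}"
    and strict: "\<forall>S. S \<subseteq> min_gens ?JK \<and> S \<noteq> {} \<longrightarrow>
      mono_sdvd (mono_lcm (\<phi> ` S)) (mono_lcm S) \<and> mono_sdvd (mono_lcm (\<psi> ` S)) (mono_lcm S)"
    by (elim exE conjE) (rule that)
  \<comment> \<open>J has the single generator uv, so \<open>\<phi>\<close> is constant and
    \<open>w\<close> is the lcm of uv and \<open>\<psi> w\<close>.\<close>
  have \<psi>: "\<psi> w \<in> edge_monos ?K" "w = ?m + (\<psi> w - ?m)" if "w \<in> min_gens ?JK" for w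
  proof -
    have *: "\<phi> w \<in> {?m}" "\<psi> w \<in> edge_monos ?K" "w = mono_lcm {\<phi> w, \<psi> w}"
      using bspec[OF \<phi>\<psi> that] genJ genK by blast+
    show "\<psi> w \<in> edge_monos ?K" by (rule *(2))
    show "w = ?m + (\<psi> w - ?m)" using *(1,3) unfolding mono_lcm_pair by (metis singletonD)
  qed
  have "\<psi> w1 = vmon u + vmon x"
    using only[OF \<psi>(1)[OF w1] \<psi>(2)[OF w1] w1_def] x ne by blast
  moreover have "\<psi> w2 = vmon v + vmon y"
    using only[OF \<psi>(1)[OF w2] \<psi>(2)[OF w2] w2_def] y ne by blast
  ultimately have "mono_sdvd (mono_lcm {vmon u + vmon x, vmon v + vmon y}) (mono_lcm {w1, w2})"
    using spec[OF strict, of "{w1, w2}"] w1 w2 by simp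
  moreover have "mono_lcm {vmon u + vmon x, vmon v + vmon y} = mono_lcm {w1, w2}"
    unfolding mono_lcm_pair w1_def w2_def using ne x(2) y(2)
    by (intro poly_mapping_eqI) (auto simp: lookup_add lookup_minus lookup_single when_def)
  ultimately show False by (simp add: mono_sdvd_def)
qed

text \<open>The colon ideal \<open>I(G - e) : uv\<close> is generated by the vertices adjacent to \<open>u\<close> or \<open>v\<close> together with
  \<open>I(H)\<close>; its multiple by \<open>v\<close> lies in \<open>I(G - e)\<close> by the hypothesis on the neighbourhoods.\<close>

lemma tor_quot_edge_ideal:
  fixes G H :: "'v::finite graph"
  assumes G: "simple_graph G" and uv: "{u, v} \<in> edges G"
    and N: "nbrs G u - {v} \<subseteq> nbrs G v"
    and H: "H = del_verts G (nbrs G u \<union> nbrs G v)"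
  shows "tor_quot (edge_ideal G :: ('v, 'k::field) mpoly set) =
    tor_quot (edge_ideal (del_edge G {u, v}) :: ('v, 'k) mpoly set) \<union>
    {(Suc i, j + 2) | i j. (i, j) \<in> tor_quot
      (ideal_gen (monom ` (vmon ` (nbrs G u \<union> nbrs G v - {u, v}) \<union> edge_monos H)) :: ('v, 'k) mpoly set)}"
proof -
  let ?K = "del_edge G {u, v}" and ?m = "vmon u + vmon v"
  let ?N = "nbrs G u \<union> nbrs G v"
  let ?L = "vmon ` (?N - {u, v}) \<union> edge_monos H"
  have card2: "a \<noteq> b" if "{a, b} \<in> edges G" for a b
    using G that by (auto simp: simple_graph_def dest!: bspec)
  have "u \<noteq> v" using card2[OF uv] .
  have uvN: "u \<in> ?N" "v \<in> ?N" using uv by (auto simp: nbrs_def insert_commute)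
  have eK: "{a, b} \<in> edges ?K \<longleftrightarrow> {a, b} \<in> edges G \<and> {a, b} \<noteq> {u, v}" for a b
    by (simp add: del_edge_def)
  have eH: "{a, b} \<in> edges H \<longleftrightarrow> {a, b} \<in> edges G \<and> a \<notin> ?N \<and> b \<notin> ?N" for a b
    by (auto simp: H del_verts_def)
  have mG: "edge_monos G = insert ?m (edge_monos ?K)"
  proof
    show "edge_monos G \<subseteq> insert ?m (edge_monos ?K)"
    proof
      fix t assume "t \<in> edge_monos G"
      then obtain a b where ab: "{a, b} \<in> edges G" "t = vmon a + vmon b" by (auto simp: edge_monos_def)
      show "t \<in> insert ?m (edge_monos ?K)"
      proof (cases "{a, b} = {u, v}")
        case True
        then have "t = ?m" using ab(2) by (auto simp: doubleton_eq_iff add.commute)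
        then show ?thesis by simp
      qed (use ab eK in \<open>auto simp: edge_mono_iff\<close>)
    qed
    show "insert ?m (edge_monos ?K) \<subseteq> edge_monos G"
      using uv by (auto simp: edge_mono_iff) (auto simp: edge_monos_def del_edge_def)
  qed
  have minus1: "vmon a + vmon b - ?m = vmon b" if "a \<in> {u, v}" "b \<notin> {u, v}" for a b
    using that \<open>u \<noteq> v\<close>
    by (intro poly_mapping_eqI) (auto simp: lookup_add lookup_minus lookup_single when_def)
  have minus2: "vmon a + vmon b - ?m = vmon a + vmon b" if "a \<notin> {u, v}" "b \<notin> {u, v}" for a b
    using that by (intro poly_mapping_eqI) (auto simp: lookup_add lookup_minus lookup_single when_def)
  have dvd_add: "mono_dvd (vmon a) (vmon a + vmon b)" "mono_dvd (vmon b) (vmon a + vmon b)" for a b :: 'v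
    by (simp_all add: mono_dvd_iff lookup_add)
  \<comment> \<open>Dividing by the gcd with uv takes an edge that meets {u, v} to its other end and
    leaves the remaining edges alone. Of the latter, those that meet \<open>?N\<close> are multiples
    of one of the variables, and the others are the edges of H.\<close>
  have colon: "ideal_gen (monom ` ?L) =
      (ideal_gen (monom ` (\<lambda>t. t - ?m) ` edge_monos ?K) :: ('v, 'k) mpoly set)"
  proof (rule ideal_gen_monom_eqI)
    fix l assume "l \<in> ?L"
    then show "\<exists>t\<in>(\<lambda>t. t - ?m) ` edge_monos ?K. mono_dvd t l"
    proof
      assume "l \<in> vmon ` (?N - {u, v})"
      then obtain y a where y: "l = vmon y" "y \<notin> {u, v}" "a \<in> {u, v}" "{a, y} \<in> edges G"
        by (auto simp: nbrs_def)
      then have "vmon a + vmon y \<in> edge_monos ?K" by (auto simp: edge_mono_iff eK)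
      then show ?thesis using minus1[OF y(3,2)] y(1) by (metis image_eqI mono_dvd_refl)
    next
      assume "l \<in> edge_monos H"
      then obtain a b where ab: "{a, b} \<in> edges H" "l = vmon a + vmon b" by (auto simp: edge_monos_def)
      then have *: "a \<notin> {u, v}" "b \<notin> {u, v}" "{a, b} \<in> edges G" using eH uvN by blast+
      then have "l \<in> edge_monos ?K" using ab(2) by (auto simp: edge_mono_iff eK)
      then show ?thesis using minus2[OF *(1,2)] ab(2) by (metis image_eqI mono_dvd_refl)
    qed
  next
    fix t assume "t \<in> (\<lambda>t. t - ?m) ` edge_monos ?K"
    then obtain a b where ab: "{a, b} \<in> edges ?K" "t = vmon a + vmon b - ?m" by (auto simp: edge_monos_def)
    then have e: "{a, b} \<in> edges G" "{b, a} \<in> edges G" "a \<noteq> b" "{a, b} \<noteq> {u, v}"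
      using eK card2 by (auto simp: insert_commute)
    consider "a \<in> {u, v}" "b \<notin> {u, v}" | "b \<in> {u, v}" "a \<notin> {u, v}" | "a \<notin> {u, v}" "b \<notin> {u, v}"
      using e(3,4) by blast
    then show "\<exists>l\<in>?L. mono_dvd l t"
    proof cases
      case 1
      then have "b \<in> ?N" using e by (auto simp: nbrs_def)
      then show ?thesis using minus1[OF 1] ab(2) 1(2) by (intro bexI[of _ "vmon b"]) auto
    next
      case 2
      then have "a \<in> ?N" using e by (auto simp: nbrs_def)
      then show ?thesis using minus1[OF 2] ab(2) 2(2)
        by (intro bexI[of _ "vmon a"]) (auto simp: add.commute)
    next
      case 3
      show ?thesis
      proof (cases "a \<in> ?N \<or> b \<in> ?N")
        case True
        then obtain c where "c \<in> ?N - {u, v}" "mono_dvd (vmon c) (vmon a + vmon b)"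
          using 3 dvd_add by blast
        then show ?thesis using minus2[OF 3] ab(2) by (intro bexI[of _ "vmon c"]) auto
      next
        case False
        then have "vmon a + vmon b \<in> edge_monos H" using e(1) eH by (simp add: edge_mono_iff)
        then show ?thesis using minus2[OF 3] ab(2) by (intro bexI[of _ "vmon a + vmon b"]) auto
      qed
    qed
  qed
  have mult: "\<exists>t\<in>edge_monos ?K. mono_dvd t (vmon v + l)" if "l \<in> ?L" for l
    using that
  proof
    assume "l \<in> vmon ` (?N - {u, v})"
    then obtain y where y: "l = vmon y" "y \<noteq> u" "{v, y} \<in> edges G" using N by (auto simp: nbrs_def)
    then have "vmon v + vmon y \<in> edge_monos ?K" by (auto simp: edge_mono_iff eK doubleton_eq_iff)
    then show ?thesis using y(1) by (intro bexI[of _ "vmon v + vmon y"]) simp_all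
  next
    assume "l \<in> edge_monos H"
    then obtain a b where ab: "{a, b} \<in> edges H" "l = vmon a + vmon b" by (auto simp: edge_monos_def)
    then have "l \<in> edge_monos ?K" using eH uvN by (auto simp: edge_mono_iff eK doubleton_eq_iff)
    moreover have "mono_dvd l (vmon v + l)" by (simp add: mono_dvd_iff lookup_add)
    ultimately show ?thesis by blast
  qed
  have "finite ?L" using finite_edge_monos[of H] by simp
  \<comment> \<open>The instance \<open>x = u\<close>, \<open>s = vmon v\<close>; its shift 1 + deg
    v is the 2 of the statement.\<close>
  from tor_quot_insert[OF finite_edge_monos this colon mult]
  show ?thesis by (simp add: edge_ideal_eq mG)
qed

section \<open>The formulas for regularity and projective dimension\<close>

theorem corollary3p7:
  fixes G H :: "'v::finite graph" and u v :: 'v and n :: int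
  assumes "simple_graph G"
    and "verts G = UNIV"
    and "splitting_edge TYPE('k::field) G u v"
    and "H = del_verts G (nbrs G u \<union> nbrs G v)"
    and "n = int (card (nbrs G u \<union> nbrs G v)) - 2"
  shows "reg (edge_ideal G :: ('v, 'k) mpoly set) =
      Max {2, reg (edge_ideal (del_edge G {u, v}) :: ('v, 'k) mpoly set),
           reg (edge_ideal H :: ('v, 'k) mpoly set) + 1} \<and>
    pd (edge_ideal G :: ('v, 'k) mpoly set) =
      max (pd (edge_ideal (del_edge G {u, v}) :: ('v, 'k) mpoly set))
          (pd (edge_ideal H :: ('v, 'k) mpoly set) + n + 1)"
proof -
  let ?N = "nbrs G u \<union> nbrs G v"
  let ?K = "del_edge G {u, v}"
  let ?Y = "?N - {u, v}"
  let ?L = "ideal_gen (monom ` (vmon ` ?Y \<union> edge_monos H)) :: ('v, 'k) mpoly set"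
  let ?IG = "edge_ideal G :: ('v, 'k) mpoly set" and ?IK = "edge_ideal ?K :: ('v, 'k) mpoly set"
    and ?IH = "edge_ideal H :: ('v, 'k) mpoly set"
  have uv: "{u, v} \<in> edges G" using assms(3) by (simp add: splitting_edge_def)
  then have "card {u, v} = 2" using assms(1) by (auto simp: simple_graph_def)
  then have "u \<noteq> v" by auto
  have uvN: "{u, v} \<subseteq> ?N" using uv by (auto simp: nbrs_def insert_commute)
  \<comment> \<open>u and v are neighbours of each other, so both lie in \<open>?N\<close>;
    subtracting 2 discounts them.\<close>
  have n: "n = int (card ?Y)"
    using assms(5) card_Diff_subset[OF _ uvN] card_mono[OF _ uvN] \<open>card {u, v} = 2\<close> by simp
  \<comment> \<open>\<open>?L\<close> and the edge are symmetric in u and v, so either inclusion of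
    neighbourhoods will do.\<close>
  have QG: "tor_quot ?IG = tor_quot ?IK \<union> {(Suc i, j + 2) | i j. (i, j) \<in> tor_quot ?L}"
    using splitting_edge_nbrs[OF assms(1,3)]
  proof
    assume "nbrs G u - {v} \<subseteq> nbrs G v"
    then show ?thesis by (rule tor_quot_edge_ideal[OF assms(1) uv _ assms(4)])
  next
    assume "nbrs G v - {u} \<subseteq> nbrs G u"
    moreover have "{v, u} \<in> edges G" using uv by (simp add: insert_commute)
    moreover have "H = del_verts G (nbrs G v \<union> nbrs G u)" using assms(4) by (simp add: Un_commute)
    ultimately show ?thesis
      using tor_quot_edge_ideal[of G v u H, OF assms(1)] by (simp add: Un_commute insert_commute)
  qed
  have L: "max_reg (tor_quot ?L) = max_reg (tor_quot ?IH)" "max_pd (tor_quot ?L) = max_pd (tor_quot ?IH) + n"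
  proof -
    have free: "Poly_Mapping.lookup t y = 0" if "y \<in> ?Y" "t \<in> edge_monos H" for y t
      using that by (auto simp: edge_monos_def assms(4) del_verts_def lookup_add lookup_single when_def)
    have "max_reg (tor_quot ?L) = max_reg (tor_quot ?IH) \<and>
        max_pd (tor_quot ?L) = max_pd (tor_quot ?IH) + int (card ?Y)"
      unfolding edge_ideal_eq
      by (rule max_reg_pd_adjoin_vars[OF _ finite_edge_monos edge_monos_nonzero free]) simp_all
    then show "max_reg (tor_quot ?L) = max_reg (tor_quot ?IH)" "max_pd (tor_quot ?L) = max_pd (tor_quot ?IH) + n"
      by (simp_all add: n)
  qed
  have fin: "finite (vmon ` ?Y \<union> edge_monos H)" using finite_edge_monos[of H] by simp
  have nz: "0 \<notin> vmon ` ?Y \<union> edge_monos H"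
    using edge_monos_nonzero[of H] vmon_neq_0(1) by (auto dest: sym)
  have QL: "finite (tor_quot ?L)" "(0, 0) \<in> tor_quot ?L"
    by (rule tor_quot_monomial_ideal(1)[OF fin nz refl])
      (simp only: tor_quot_monomial_ideal(2)[OF fin nz refl])
  have QE: "finite (tor_quot (edge_ideal F :: ('v, 'k) mpoly set))"
    "(0, 0) \<in> tor_quot (edge_ideal F :: ('v, 'k) mpoly set)" for F :: "'v graph"
    by (rule tor_quot_monomial_ideal(1)[OF finite_edge_monos edge_monos_nonzero edge_ideal_eq])
      (simp only: tor_quot_monomial_ideal(2)[OF finite_edge_monos edge_monos_nonzero edge_ideal_eq])
  note eq = reg_pd_eq[OF finite_edge_monos edge_monos_nonzero edge_ideal_eq]
  have "tor_quot ?IK \<noteq> {}" "tor_quot ?L \<noteq> {}" using QL(2) QE(2) by blast+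
  \<comment> \<open>The final 2 is the degree of uv: the contribution of \<open>?L\<close> gains 1
    in regularity and 1 in projective dimension.\<close>
  note M = max_reg_pd_union[OF QE(1) this(1) QL(1) this(2), of 2, folded QG]
  \<comment> \<open>The pair (0, 0) gives this bound even if H has no edges. Hence the third entry
    of the maximum is at least 2, which accounts for the entry 2.\<close>
  have "0 \<le> max_reg (tor_quot ?IH)"
    unfolding max_reg_def using QE by (intro Max_ge) force+
  then show ?thesis
    unfolding eq M L by (auto simp: max_def)
qed

end
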